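(* The problem defined in the context can be solved in $2^{\mathcal{O}(k\log k)}\,n^3$ time, where $n$ is the number of vertices of the input graph and $k=|S|$ is the number of terminals in each terminal multiset.
   Context: Consider the following problem. Input: a directed graph $G=(V,A)$, an edge-weight function $w\colon A\to\mathbb{Q}_{\ge 0}$, two multisets $S$ and $T$ of vertices of $G$ with $|S|=|T|$, and an integer $\ell$. Question: is there a set $K\subseteq A$ of edges of total weight at most $\ell$ and a bijection $f\colon S\to T$ (between the multisets, counting multiplicities) such that for each $s\in S$ there is a directed path from $s$ to $f(s)$ using only edges of $K$? *)

theory Defs
  imports Complex_Main "HOL-Library.Multiset" "HOL-Library.Landau_Symbols"
begin

section \<open>The problem\<close>

text \<open>
  The vertices of an instance are the numbers below \<open>nverts\<close>, and \<open>arcs\<close> is a simple directed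
  graph on them (loops and antiparallel arcs are allowed, parallel arcs are not). The values of
  \<open>weight\<close> outside \<open>arcs\<close> are irrelevant.
\<close>

record inst =
  nverts :: nat
  arcs :: "(nat \<times> nat) set"
  weight :: "nat \<times> nat \<Rightarrow> rat"
  sources :: "nat multiset"
  targets :: "nat multiset"
  budget :: int

definition wf_inst :: "inst \<Rightarrow> bool" where
  "wf_inst I \<longleftrightarrow>
     0 < nverts I \<and>
     arcs I \<subseteq> {..<nverts I} \<times> {..<nverts I} \<and>
     (\<forall>e\<in>arcs I. 0 \<le> weight I e) \<and>
     set_mset (sources I) \<subseteq> {..<nverts I} \<and>
     set_mset (targets I) \<subseteq> {..<nverts I} \<and>
     size (sources I) = size (targets I)"

text \<open>A bijection between multisets is a bijection between their sets of tagged occurrences.\<close>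

definition occs :: "'a multiset \<Rightarrow> ('a \<times> nat) set" where
  "occs M = {(x, i). i < count M x}"

definition yes_inst :: "inst \<Rightarrow> bool" where
  "yes_inst I \<longleftrightarrow>
     (\<exists>K f. K \<subseteq> arcs I \<and>
            (\<Sum>e\<in>K. weight I e) \<le> of_int (budget I) \<and>
            bij_betw f (occs (sources I)) (occs (targets I)) \<and>
            (\<forall>s\<in>occs (sources I). (fst s, fst (f s)) \<in> K\<^sup>*))"


section \<open>The machine model\<close>

text \<open>
  Programs run on a random access machine with words (natural numbers) and weights (rational
  numbers), each stored in zero-initialised arrays with arbitrary indexing; the number of arrays is
  fixed by the program, and a scalar is cell 0 of an array. Weights can only be copied, added and
  compared. Every operation on words and weights, including memory access, takes unit time.
\<close>

type_synonym vname = string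

record state =
  words :: "vname \<Rightarrow> nat \<Rightarrow> nat"
  weights :: "vname \<Rightarrow> nat \<Rightarrow> rat"

datatype aexp =
    N nat
  | Get vname aexp
  | Plus aexp aexp
  | Minus aexp aexp
  | Times aexp aexp
  | Div aexp aexp
  | Mod aexp aexp

datatype wexp =
    WConst rat
  | WGet vname aexp
  | WPlus wexp wexp

datatype bexp =
    Less aexp aexp
  | WLess wexp wexp
  | Not bexp
  | And bexp bexp

datatype com =
    Skip
  | Put vname aexp aexp
  | WPut vname aexp wexp
  | Seq com com
  | Cond bexp com com
  | While bexp com

primrec aval :: "aexp \<Rightarrow> state \<Rightarrow> nat" where
  "aval (N c) s = c"
| "aval (Get x a) s = words s x (aval a s)"
| "aval (Plus a b) s = aval a s + aval b s"
| "aval (Minus a b) s = aval a s - aval b s"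
| "aval (Times a b) s = aval a s * aval b s"
| "aval (Div a b) s = aval a s div aval b s"
| "aval (Mod a b) s = aval a s mod aval b s"

primrec wval :: "wexp \<Rightarrow> state \<Rightarrow> rat" where
  "wval (WConst c) s = c"
| "wval (WGet x a) s = weights s x (aval a s)"
| "wval (WPlus a b) s = wval a s + wval b s"

primrec bval :: "bexp \<Rightarrow> state \<Rightarrow> bool" where
  "bval (Less a b) s \<longleftrightarrow> aval a s < aval b s"
| "bval (WLess a b) s \<longleftrightarrow> wval a s < wval b s"
| "bval (Not b) s \<longleftrightarrow> \<not> bval b s"
| "bval (And b c) s \<longleftrightarrow> bval b s \<and> bval c s"

text \<open>
  The word size is bounded: \<open>afits B e s\<close> states that no word arising in the evaluation of \<open>e\<close>,
  final result included, exceeds \<open>B\<close>. This rules out the use of huge integers as a resource.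
\<close>

primrec afits :: "nat \<Rightarrow> aexp \<Rightarrow> state \<Rightarrow> bool" where
  "afits B (N c) s \<longleftrightarrow> c \<le> B"
| "afits B (Get x a) s \<longleftrightarrow> afits B a s \<and> aval (Get x a) s \<le> B"
| "afits B (Plus a b) s \<longleftrightarrow> afits B a s \<and> afits B b s \<and> aval (Plus a b) s \<le> B"
| "afits B (Minus a b) s \<longleftrightarrow> afits B a s \<and> afits B b s \<and> aval (Minus a b) s \<le> B"
| "afits B (Times a b) s \<longleftrightarrow> afits B a s \<and> afits B b s \<and> aval (Times a b) s \<le> B"
| "afits B (Div a b) s \<longleftrightarrow> afits B a s \<and> afits B b s \<and> aval (Div a b) s \<le> B"
| "afits B (Mod a b) s \<longleftrightarrow> afits B a s \<and> afits B b s \<and> aval (Mod a b) s \<le> B"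

primrec wfits :: "nat \<Rightarrow> wexp \<Rightarrow> state \<Rightarrow> bool" where
  "wfits B (WConst c) s \<longleftrightarrow> True"
| "wfits B (WGet x a) s \<longleftrightarrow> afits B a s"
| "wfits B (WPlus a b) s \<longleftrightarrow> wfits B a s \<and> wfits B b s"

primrec bfits :: "nat \<Rightarrow> bexp \<Rightarrow> state \<Rightarrow> bool" where
  "bfits B (Less a b) s \<longleftrightarrow> afits B a s \<and> afits B b s"
| "bfits B (WLess a b) s \<longleftrightarrow> wfits B a s \<and> wfits B b s"
| "bfits B (Not b) s \<longleftrightarrow> bfits B b s"
| "bfits B (And b c) s \<longleftrightarrow> bfits B b s \<and> bfits B c s"

primrec acost :: "aexp \<Rightarrow> nat" where
  "acost (N c) = 1"
| "acost (Get x a) = acost a + 1"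
| "acost (Plus a b) = acost a + acost b + 1"
| "acost (Minus a b) = acost a + acost b + 1"
| "acost (Times a b) = acost a + acost b + 1"
| "acost (Div a b) = acost a + acost b + 1"
| "acost (Mod a b) = acost a + acost b + 1"

primrec wcost :: "wexp \<Rightarrow> nat" where
  "wcost (WConst c) = 1"
| "wcost (WGet x a) = acost a + 1"
| "wcost (WPlus a b) = wcost a + wcost b + 1"

primrec bcost :: "bexp \<Rightarrow> nat" where
  "bcost (Less a b) = acost a + acost b + 1"
| "bcost (WLess a b) = wcost a + wcost b + 1"
| "bcost (Not b) = bcost b + 1"
| "bcost (And b c) = bcost b + bcost c + 1"

definition put :: "vname \<Rightarrow> nat \<Rightarrow> nat \<Rightarrow> state \<Rightarrow> state" where
  "put x i v s = s\<lparr>words := (words s)(x := (words s x)(i := v))\<rparr>"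

definition wput :: "vname \<Rightarrow> nat \<Rightarrow> rat \<Rightarrow> state \<Rightarrow> state" where
  "wput x i q s = s\<lparr>weights := (weights s)(x := (weights s x)(i := q))\<rparr>"

text \<open>
  \<open>exec B c s t s'\<close>: started in \<open>s\<close>, the program \<open>c\<close> halts in \<open>s'\<close> after exactly \<open>t\<close> time units
  without any word exceeding \<open>B\<close>. A computation that overflows is stuck, i.e. has no derivation.
\<close>

inductive exec :: "nat \<Rightarrow> com \<Rightarrow> state \<Rightarrow> nat \<Rightarrow> state \<Rightarrow> bool" for B :: nat where
  Skip: "exec B Skip s 1 s"
| Put: "afits B a s \<Longrightarrow> afits B b s \<Longrightarrow>
    exec B (Put x a b) s (acost a + acost b + 1) (put x (aval a s) (aval b s) s)"
| WPut: "afits B a s \<Longrightarrow> wfits B e s \<Longrightarrow>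
    exec B (WPut x a e) s (acost a + wcost e + 1) (wput x (aval a s) (wval e s) s)"
| Seq: "exec B c1 s t1 s1 \<Longrightarrow> exec B c2 s1 t2 s2 \<Longrightarrow> exec B (Seq c1 c2) s (t1 + t2) s2"
| CondTrue: "bfits B b s \<Longrightarrow> bval b s \<Longrightarrow> exec B c1 s t s' \<Longrightarrow>
    exec B (Cond b c1 c2) s (bcost b + t + 1) s'"
| CondFalse: "bfits B b s \<Longrightarrow> \<not> bval b s \<Longrightarrow> exec B c2 s t s' \<Longrightarrow>
    exec B (Cond b c1 c2) s (bcost b + t + 1) s'"
| WhileFalse: "bfits B b s \<Longrightarrow> \<not> bval b s \<Longrightarrow> exec B (While b c) s (bcost b + 1) s"
| WhileTrue: "bfits B b s \<Longrightarrow> bval b s \<Longrightarrow> exec B c s t1 s1 \<Longrightarrow> exec B (While b c) s1 t2 s2 \<Longrightarrow>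
    exec B (While b c) s (bcost b + t1 + t2 + 1) s2"

text \<open>
  Within time bound \<open>t\<close> only words of value at most \<open>t\<close> may be used, that is, the word length is
  logarithmic in the time bound, just enough to address the memory that can be visited. The answer
  is left in the scalar \<open>out\<close>.
\<close>

definition decides_within :: "com \<Rightarrow> state \<Rightarrow> nat \<Rightarrow> bool \<Rightarrow> bool" where
  "decides_within P s t answer \<longleftrightarrow>
     (\<exists>t' s'. exec t P s t' s' \<and> t' \<le> t \<and> words s' ''out'' 0 = (if answer then 1 else 0))"


section \<open>Encoding of instances\<close>

definition scalar :: "'a \<Rightarrow> nat \<Rightarrow> 'a::zero" where
  "scalar c = (\<lambda>i. if i = 0 then c else 0)"

definition array :: "'a list \<Rightarrow> nat \<Rightarrow> 'a::zero" where
  "array xs = (\<lambda>i. if i < length xs then xs ! i else 0)"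

text \<open>
  The graph is given by its adjacency matrix and weight matrix, stored row by row, and the two
  multisets by arbitrary enumerations \<open>xs\<close> and \<open>ys\<close>. The integer budget is stored as a weight.
\<close>

definition init_state :: "inst \<Rightarrow> nat list \<Rightarrow> nat list \<Rightarrow> state" where
  "init_state I xs ys =
     (let n = nverts I in
      \<lparr>words = (\<lambda>_ _. 0)
         (''n'' := scalar n,
          ''k'' := scalar (length xs),
          ''S'' := array xs,
          ''T'' := array ys,
          ''A'' := (\<lambda>i. if (i div n, i mod n) \<in> arcs I then 1 else 0)),
       weights = (\<lambda>_ _. 0)
         (''w'' := (\<lambda>i. if (i div n, i mod n) \<in> arcs I then weight I (i div n, i mod n) else 0),
          ''l'' := scalar (of_int (budget I)))\<rparr>)"

end

theory Submission
  imports Defs "HOL-Library.Nat_Bijection"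
begin

text \<open>
  Since the matching of sources to targets is free, an edge set is feasible iff it carries a flow
  from the sources to the targets, and a flow of inclusion-minimal support has a forest as support.
  A dynamic programme in the style of Dreyfus and Wagner therefore applies: for a set \<open>X\<close> of terminals
  and a vertex \<open>v\<close> it computes the least cost of gathering \<open>X\<close> at \<open>v\<close>, where the sign of the imbalance
  of \<open>X\<close> (sources minus targets) fixes the direction in which the next edge is used. An edge is paid
  once, however many paths share it, and a balanced set may change its vertex for free. The table
  has \<open>4 ^ k * n\<close> entries, and \<open>(2 * k + 4) * n\<close> rounds of relaxing all entries by all rules suffice,
  because a forest can be dismantled leaf by leaf with two rounds per vertex.
\<close>

section \<open>Flows and circulations\<close>

text \<open>Correctness splits into two one-sided claims. Soundness: every entry of value at most
  \<open>l\<close> is certified by an edge set of at most that weight. Completeness: the final entry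
  is at most the weight of any feasible edge set. Entries only ever decrease and completeness asks
  only for upper bounds, so any order of relaxations inside a round works and all rounds fit into
  one flat loop over a counter. Completeness takes a rational flow inside a feasible edge set, which
  turns the removal of cycles into linear algebra: if all degrees in the support are at least two,
  it carries a nonzero signed circulation, and subtracting a multiple of it shrinks the support. At
  a leaf, the flow on the single edge equals the imbalance of the terminals gathered there; this is
  why the sign alone decides the direction. A round tries all pairs of codes with all pairs of
  vertices, \<open>16 ^ k * n ^ 2\<close> steps, and the number of rounds is linear in
  \<open>n\<close>: hence the cubic factor. The machine has no bitwise operations, so disjointness
  of codes is tested by counting ones before and after addition.\<close>

lemma homogeneous_system_nontrivial:
  fixes a :: "'i \<Rightarrow> 'j \<Rightarrow> 'f::field"
  assumes "finite I" "finite J" "card I < card J"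
  shows "\<exists>z. (\<exists>j\<in>J. z j \<noteq> 0) \<and> (\<forall>i\<in>I. (\<Sum>j\<in>J. a i j * z j) = 0)"
  using assms
proof (induction I arbitrary: J a rule: finite_induct)
  case empty
  then have "J \<noteq> {}" by auto
  then show ?case by (intro exI[of _ "\<lambda>_. 1"]) auto
next
  case (insert i I)
  show ?case
  proof (cases "\<forall>j\<in>J. a i j = 0")
    case True
    have "card I < card J" using insert by simp
    from insert.IH[OF insert.prems(1) this, of a] obtain z where
      "\<exists>j\<in>J. z j \<noteq> 0" "\<forall>i\<in>I. (\<Sum>j\<in>J. a i j * z j) = 0" by blast
    with True show ?thesis by (intro exI[of _ z]) auto
  next
    case False
    \<comment> \<open>Gaussian elimination: \<open>p\<close> is the pivot of equation
      \<open>i\<close>. The other equations are solved with \<open>p\<close> eliminated, and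
      \<open>c\<close> is the value of \<open>p\<close> that then satisfies equation
      \<open>i\<close>.\<close>
    then obtain p where p: "p \<in> J" "a i p \<noteq> 0" by blast
    define J' where "J' = J - {p}"
    have J': "finite J'" "J = insert p J'" "p \<notin> J'" "card I < card J'"
      using insert p by (auto simp: J'_def)
    from insert.IH[OF J'(1,4), of "\<lambda>i' j. a i' j - a i' p * a i j / a i p"] obtain z where
      z: "\<exists>j\<in>J'. z j \<noteq> 0"
         "\<forall>i'\<in>I. (\<Sum>j\<in>J'. (a i' j - a i' p * a i j / a i p) * z j) = 0" by blast
    define c where "c = - (\<Sum>j\<in>J'. a i j * z j) / a i p"
    define z' where "z' = z(p := c)"
    have sum: "(\<Sum>j\<in>J. a i' j * z' j) = a i' p * c + (\<Sum>j\<in>J'. a i' j * z j)" for i'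
    proof -
      have "(\<Sum>j\<in>J'. a i' j * z' j) = (\<Sum>j\<in>J'. a i' j * z j)"
        by (intro sum.cong) (use J' in \<open>auto simp: z'_def\<close>)
      then show ?thesis using J' by (simp add: z'_def)
    qed
    have "(\<Sum>j\<in>J. a i' j * z' j) = 0" if "i' \<in> insert i I" for i'
    proof (cases "i' = i")
      case True
      then show ?thesis using p by (simp add: sum c_def)
    next
      case False
      with that have "(\<Sum>j\<in>J'. (a i' j - a i' p * a i j / a i p) * z j) = 0" using z by blast
      also have "(\<Sum>j\<in>J'. (a i' j - a i' p * a i j / a i p) * z j)
        = (\<Sum>j\<in>J'. a i' j * z j) + a i' p * c"
        by (simp add: c_def sum_subtractf left_diff_distrib sum_distrib_left sum_divide_distrib mult.assoc)
      finally show ?thesis by (simp add: sum add.commute)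
    qed
    moreover have "\<exists>j\<in>J. z' j \<noteq> 0" using z(1) J' by (auto simp: z'_def)
    ultimately show ?thesis by blast
  qed
qed

section \<open>Divergence of edge functions and signed circulations\<close>

definition divergence :: "nat \<Rightarrow> (nat \<times> nat \<Rightarrow> rat) \<Rightarrow> nat \<Rightarrow> rat" where
  "divergence n \<phi> v = (\<Sum>u<n. \<phi> (v, u)) - (\<Sum>u<n. \<phi> (u, v))"

lemma divergence_add:
  "divergence n (\<lambda>e. \<phi> e + \<psi> e) v = divergence n \<phi> v + divergence n \<psi> v"
  by (simp add: divergence_def sum.distrib)

lemma divergence_scale:
  "divergence n (\<lambda>e. c * \<phi> e) v = c * divergence n \<phi> v"
  by (simp add: divergence_def sum_distrib_left right_diff_distrib)

lemma divergence_sum: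
  "finite J \<Longrightarrow> divergence n (\<lambda>e. \<Sum>j\<in>J. \<phi> j e) v = (\<Sum>j\<in>J. divergence n (\<phi> j) v)"
  by (induction J rule: finite_induct) (simp_all add: divergence_add, simp add: divergence_def)

lemma divergence_single:
  assumes "fst e < n" "snd e < n"
  shows "divergence n (\<lambda>e'. if e' = e then c else 0) v
    = (if v = fst e then c else 0) - (if v = snd e then c else 0)"
proof -
  have "(\<Sum>u<n. if (v, u) = e then c else 0) = (if v = fst e then c else 0)"
  proof (cases "v = fst e")
    case True
    then have "(\<Sum>u<n. if (v, u) = e then c else 0) = (\<Sum>u<n. if u = snd e then c else 0)"
      by (intro sum.cong) (auto simp: prod_eq_iff)
    then show ?thesis using assms True by simp
  qed (auto intro!: sum.neutral)
  moreover have "(\<Sum>u<n. if (u, v) = e then c else 0) = (if v = snd e then c else 0)"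
  proof (cases "v = snd e")
    case True
    then have "(\<Sum>u<n. if (u, v) = e then c else 0) = (\<Sum>u<n. if u = fst e then c else 0)"
      by (intro sum.cong) (auto simp: prod_eq_iff)
    then show ?thesis using assms True by simp
  qed (auto intro!: sum.neutral)
  ultimately show ?thesis by (simp add: divergence_def)
qed

lemma sum_divergence: "(\<Sum>v<n. divergence n \<phi> v) = 0"
  unfolding divergence_def sum_subtractf using sum.swap[of "\<lambda>u v. \<phi> (u, v)" "{..<n}" "{..<n}"] by simp

definition supp :: "(nat \<times> nat \<Rightarrow> rat) \<Rightarrow> (nat \<times> nat) set" where
  "supp \<phi> = {e. \<phi> e \<noteq> 0}"

definition ends :: "(nat \<times> nat) set \<Rightarrow> nat set" where
  "ends D = fst ` D \<union> snd ` D"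

definition incident :: "(nat \<times> nat) set \<Rightarrow> nat \<Rightarrow> (nat \<times> nat) set" where
  "incident D x = {e \<in> D. fst e = x \<or> snd e = x}"

text \<open>Conservation is a linear system with one unknown per edge and one equation per vertex.
  Degrees of at least two give at most as many vertices as edges, and one equation follows from the
  others because all divergences sum to zero. So a nonzero solution exists; its values may have
  either sign.\<close>

lemma circulation_exists:
  assumes D: "D \<subseteq> {..<n} \<times> {..<n}" "D \<noteq> {}"
    and deg: "\<And>x. x \<in> ends D \<Longrightarrow> 2 \<le> card (incident D x)"
  shows "\<exists>z. supp z \<subseteq> D \<and> supp z \<noteq> {} \<and> (\<forall>v<n. divergence n z v = 0)"
proof -
  have finD: "finite D" by (rule finite_subset[OF D(1)]) simp
  have endsn: "ends D \<subseteq> {..<n}" using D(1) by (auto simp: ends_def)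
  then have finE: "finite (ends D)" by (rule finite_subset) simp
  \<comment> \<open>Double counting of incidences: at least two edges per vertex, at most two
    vertices per edge, where a loop counts once.\<close>
  have "2 * card (ends D) = (\<Sum>x\<in>ends D. 2)" by simp
  also have "\<dots> \<le> (\<Sum>x\<in>ends D. card (incident D x))" by (intro sum_mono deg)
  also have "\<dots> = (\<Sum>x\<in>ends D. \<Sum>e\<in>D. if fst e = x \<or> snd e = x then 1 else 0)"
    using finD by (auto simp: incident_def sum.If_cases Int_def intro!: sum.cong)
  also have "\<dots> = (\<Sum>e\<in>D. \<Sum>x\<in>ends D. if fst e = x \<or> snd e = x then 1 else 0)"
    by (rule sum.swap)
  also have "\<dots> \<le> (\<Sum>e\<in>D. 2)"
  proof (intro sum_mono)
    fix e
    have "(\<Sum>x\<in>ends D. if fst e = x \<or> snd e = x then 1 else 0) = card (ends D \<inter> {fst e, snd e})"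
      using finE by (auto simp: sum.If_cases Int_def intro!: arg_cong[of _ _ card])
    also have "\<dots> \<le> card {fst e, snd e}" by (intro card_mono) auto
    also have "\<dots> \<le> 2" by (simp add: card_insert_if)
    finally show "(\<Sum>x\<in>ends D. if fst e = x \<or> snd e = x then 1 else 0) \<le> (2::nat)" .
  qed
  finally have le: "card (ends D) \<le> card D" by simp
  \<comment> \<open>The equation at \<open>y\<close> is left out to make the system underdetermined;
    conservation at \<open>y\<close> returns through \<open>sum_divergence\<close>.\<close>
  obtain y where y: "y \<in> ends D" using D(2) by (auto simp: ends_def)
  have "card (ends D - {y}) < card D"
    using le y finE by (metis card_Diff1_less less_le_trans)
  from homogeneous_system_nontrivial[OF _ finD this,
      of "\<lambda>x e. (if x = fst e then 1 else 0) - (if x = snd e then 1 else (0::rat))"] finE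
  obtain z0 where z0: "\<exists>e\<in>D. z0 e \<noteq> (0::rat)" "\<forall>x\<in>ends D - {y}.
      (\<Sum>e\<in>D. ((if x = fst e then 1 else 0) - (if x = snd e then 1 else 0)) * z0 e) = 0"
    by blast
  define z where "z = (\<lambda>e. if e \<in> D then z0 e else 0)"
  have zsum: "z = (\<lambda>e. \<Sum>d\<in>D. if e = d then z0 d else 0)"
    using finD by (auto simp: z_def)
  have dz: "divergence n z x
      = (\<Sum>e\<in>D. ((if x = fst e then 1 else 0) - (if x = snd e then 1 else 0)) * z0 e)" for x
  proof -
    have "divergence n z x = (\<Sum>d\<in>D. divergence n (\<lambda>e. if e = d then z0 d else 0) x)"
      unfolding zsum by (rule divergence_sum[OF finD])
    also have "\<dots> = (\<Sum>e\<in>D. ((if x = fst e then 1 else 0) - (if x = snd e then 1 else 0)) * z0 e)"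
    proof (intro sum.cong refl)
      fix d assume "d \<in> D"
      then have "fst d < n" "snd d < n" using D(1) by auto
      then show "divergence n (\<lambda>e. if e = d then z0 d else 0) x
        = ((if x = fst d then 1 else 0) - (if x = snd d then 1 else 0)) * z0 d"
        by (simp add: divergence_single)
    qed
    finally show ?thesis .
  qed
  have other: "divergence n z x = 0" if "x \<noteq> y" for x
  proof (cases "x \<in> ends D")
    case True
    then show ?thesis using z0(2) that by (simp add: dz)
  next
    case False
    then show ?thesis unfolding dz by (intro sum.neutral) (auto simp: ends_def)
  qed
  have "divergence n z y = (\<Sum>v<n. divergence n z v)"
  proof -
    have "(\<Sum>v<n. divergence n z v) = (\<Sum>v<n. if v = y then divergence n z y else 0)"
      by (intro sum.cong) (auto simp: other)
    then show ?thesis using y endsn by auto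
  qed
  then have "divergence n z y = 0" by (simp add: sum_divergence)
  then have "\<forall>v<n. divergence n z v = 0" using other by metis
  moreover have "supp z \<subseteq> D" "supp z \<noteq> {}" using z0(1) by (auto simp: supp_def z_def)
  ultimately show ?thesis by blast
qed

text \<open>Subtracting a multiple of a circulation keeps all divergences. The largest multiple that
  leaves every value nonnegative brings some edge down to zero, so the support shrinks
  strictly.\<close>

lemma cancel_circulation:
  assumes fin: "finite (supp \<phi>)" and nonneg: "\<And>e. 0 \<le> \<phi> e"
    and z: "supp z \<subseteq> supp \<phi>" "supp z \<noteq> {}" "\<forall>v<n. divergence n z v = 0"
  shows "\<exists>\<psi>. (\<forall>e. 0 \<le> \<psi> e) \<and> supp \<psi> \<subset> supp \<phi> \<and> (\<forall>v<n. divergence n \<psi> v = divergence n \<phi> v)"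
proof -
  \<comment> \<open>A positive entry is needed to bound the multiple; this case is later applied to
    \<open>z\<close> or to its negation.\<close>
  have pos: ?thesis if z: "supp z \<subseteq> supp \<phi>" "\<forall>v<n. divergence n z v = 0" and e: "0 < z e" for z e
  proof -
    define Z where "Z = {e. 0 < z e}"
    have "Z \<subseteq> supp z" by (auto simp: Z_def supp_def)
    then have Z: "Z \<subseteq> supp \<phi>" "finite Z" "e \<in> Z"
      using e z(1) fin by (auto simp: Z_def intro: finite_subset)
    define \<theta> where "\<theta> = Min ((\<lambda>e. \<phi> e / z e) ` Z)"
    have "\<theta> \<in> (\<lambda>e. \<phi> e / z e) ` Z" unfolding \<theta>_def using Z by (intro Min_in) auto
    then obtain m where m: "m \<in> Z" "\<theta> = \<phi> m / z m" by auto
    have \<theta>_le: "\<theta> * z e \<le> \<phi> e" if "e \<in> Z" for e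
    proof -
      have "\<theta> \<le> \<phi> e / z e" unfolding \<theta>_def using Z that by (intro Min_le) auto
      then show ?thesis using that by (simp add: Z_def pos_le_divide_eq)
    qed
    have \<theta>0: "0 \<le> \<theta>" using m nonneg[of m] by (simp add: Z_def)
    define \<psi> where "\<psi> = (\<lambda>e. \<phi> e + (- \<theta>) * z e)"
    have "0 \<le> \<psi> e" for e
    proof (cases "e \<in> Z")
      case False
      then have "\<theta> * z e \<le> 0" using \<theta>0 by (simp add: Z_def mult_le_0_iff)
      then show ?thesis using nonneg[of e] by (simp add: \<psi>_def)
    qed (use \<theta>_le in \<open>simp add: \<psi>_def\<close>)
    moreover have "supp \<psi> \<subseteq> supp \<phi>" using z(1) by (auto simp: supp_def \<psi>_def)
    moreover have "\<psi> m = 0" "m \<in> supp \<phi>" using m Z by (auto simp: \<psi>_def Z_def)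
    then have "m \<in> supp \<phi> - supp \<psi>" by (simp add: supp_def)
    moreover have "\<forall>v<n. divergence n \<psi> v = divergence n \<phi> v"
      unfolding \<psi>_def divergence_add divergence_scale using z(2) by simp
    ultimately show ?thesis by blast
  qed
  from z(2) obtain e where "z e \<noteq> 0" by (auto simp: supp_def)
  then consider "0 < z e" | "0 < - z e" by linarith
  then show ?thesis
  proof cases
    case 1
    then show ?thesis using pos z by blast
  next
    case 2
    have "divergence n (\<lambda>e. - z e) v = - divergence n z v" for v
      using divergence_scale[of n "-1" z v] by simp
    then show ?thesis using pos[of "\<lambda>e. - z e" e] 2 z by (simp add: supp_def)
  qed
qed

text \<open>The unit flow along a walk: every traversal of an edge adds one, and the contributions
  at inner vertices telescope.\<close>

lemma rtrancl_flow:
  assumes "(a, b) \<in> K\<^sup>*" and "K \<subseteq> {..<n} \<times> {..<n}"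
  shows "\<exists>\<phi>. (\<forall>e. 0 \<le> \<phi> e) \<and> supp \<phi> \<subseteq> K \<and>
    (\<forall>v. divergence n \<phi> v = (if v = a then 1 else 0) - (if v = b then 1 else 0))"
  using assms(1)
proof (induction rule: rtrancl_induct)
  case base
  show ?case by (intro exI[of _ "\<lambda>_. 0"]) (auto simp: supp_def divergence_def)
next
  case (step y z)
  then obtain \<phi> where \<phi>: "\<forall>e. 0 \<le> \<phi> e" "supp \<phi> \<subseteq> K"
    "\<forall>v. divergence n \<phi> v = (if v = a then 1 else 0) - (if v = y then 1 else 0)" by blast
  have "y < n" "z < n" using step(2) assms(2) by auto
  define \<psi> where "\<psi> = (\<lambda>e. \<phi> e + (if e = (y, z) then 1 else 0))"
  have "supp \<psi> \<subseteq> K" using \<phi>(2) step(2) by (auto simp: supp_def \<psi>_def split: if_splits)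
  moreover have "divergence n \<psi> v = (if v = a then 1 else 0) - (if v = z then 1 else 0)" for v
    unfolding \<psi>_def divergence_add using \<phi>(3) \<open>y < n\<close> \<open>z < n\<close> by (simp add: divergence_single)
  moreover have "\<forall>e. 0 \<le> \<psi> e" using \<phi>(1) by (simp add: \<psi>_def)
  ultimately show ?case by blast
qed

section \<open>Completeness of the relaxation rules\<close>

lemma divergence_eq_0:
  assumes "incident (supp \<phi>) x = {}"
  shows "divergence n \<phi> x = 0"
proof -
  have "\<phi> (x, u) = 0" "\<phi> (u, x) = 0" for u
    using assms by (auto simp: incident_def supp_def)
  then show ?thesis by (simp add: divergence_def)
qed

text \<open>\<open>g r A v\<close> abstracts the entry for the terminal set \<open>A\<close> at
  \<open>v\<close> after \<open>r\<close> rounds. Only inequalities that hold for any order inside a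
  round are assumed, which keeps binary codes and loop counters out of the forest argument. In the
  application \<open>sg\<close> is \<open>1\<close> on sources and \<open>- 1\<close> on
  targets.\<close>

locale relaxation =
  fixes n :: nat and E :: "(nat \<times> nat) set" and w :: "nat \<times> nat \<Rightarrow> rat"
    and U :: "nat set" and sg :: "nat \<Rightarrow> rat" and g :: "nat \<Rightarrow> nat set \<Rightarrow> nat \<Rightarrow> rat"
  assumes n_pos: "0 < n"
    and E: "E \<subseteq> {..<n} \<times> {..<n}"
    and w_nonneg: "e \<in> E \<Longrightarrow> 0 \<le> w e"
    and finite_U: "finite U"
    and g_empty: "v < n \<Longrightarrow> g 0 {} v \<le> 0"
    and g_Suc: "A \<subseteq> U \<Longrightarrow> v < n \<Longrightarrow> g (Suc r) A v \<le> g r A v"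
    and merge: "A \<subseteq> U \<Longrightarrow> B \<subseteq> U \<Longrightarrow> A \<inter> B = {} \<Longrightarrow> v < n \<Longrightarrow>
      g (Suc r) (A \<union> B) v \<le> g r A v + g r B v"
    and forward: "A \<subseteq> U \<Longrightarrow> (x, y) \<in> E \<Longrightarrow> 0 < sum sg A \<Longrightarrow> g (Suc r) A y \<le> g r A x + w (x, y)"
    and backward: "A \<subseteq> U \<Longrightarrow> (x, y) \<in> E \<Longrightarrow> sum sg A < 0 \<Longrightarrow> g (Suc r) A x \<le> g r A y + w (x, y)"
    and jump: "A \<subseteq> U \<Longrightarrow> x < n \<Longrightarrow> y < n \<Longrightarrow> sum sg A = 0 \<Longrightarrow> g (Suc r) A y \<le> g r A x"
begin

lemma g_antimono: "r \<le> r' \<Longrightarrow> A \<subseteq> U \<Longrightarrow> v < n \<Longrightarrow> g r' A v \<le> g r A v"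
  by (induction r' rule: dec_induct) (auto intro: order_trans g_Suc)

lemma g_empty_le: "v < n \<Longrightarrow> g r {} v \<le> 0"
  using g_antimono[of 0 r "{}" v] g_empty[of v] by simp

text \<open>The end of the routing, with no edges left: every group is balanced and moves to vertex
  \<open>0\<close> for free. Each vertex costs one round to jump and one to merge.\<close>

lemma gather:
  assumes "\<And>v. v < n \<Longrightarrow> B v \<subseteq> U" "\<And>v. v < n \<Longrightarrow> sum sg (B v) = 0"
    and "\<And>u v. u < n \<Longrightarrow> v < n \<Longrightarrow> u \<noteq> v \<Longrightarrow> B u \<inter> B v = {}" and "m \<le> n"
  shows "g (r + 2 * m) (\<Union>v<m. B v) 0 \<le> (\<Sum>v<m. g r (B v) v)"
  using assms(4)
proof (induction m)
  case 0
  then show ?case using g_empty_le n_pos by simp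
next
  case (Suc m)
  have UB: "(\<Union>v<m. B v) \<subseteq> U" by (rule UN_least, rule assms(1)) (use Suc.prems in simp)
  have Bm: "B m \<subseteq> U" "sum sg (B m) = 0" using Suc.prems assms(1,2)[of m] by simp_all
  have "B v \<inter> B m = {}" if "v < m" for v
    using that Suc.prems assms(3)[of v m] by simp
  then have "(\<Union>v<m. B v) \<inter> B m = {}" by blast
  with UB Bm(1) have "g (r + 2 * Suc m) ((\<Union>v<m. B v) \<union> B m) 0
      \<le> g (r + 2 * m + 1) (\<Union>v<m. B v) 0 + g (r + 2 * m + 1) (B m) 0"
    using merge[of "\<Union>v<m. B v" "B m" 0 "r + 2 * m + 1"] n_pos by simp
  also have "\<dots> \<le> g (r + 2 * m) (\<Union>v<m. B v) 0 + g (r + 2 * m) (B m) m"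
    using g_Suc[OF UB n_pos, of "r + 2 * m"] jump[OF Bm(1) _ n_pos Bm(2), of m "r + 2 * m"] Suc.prems
    by simp
  also have "\<dots> \<le> (\<Sum>v<m. g r (B v) v) + g r (B m) m"
    using Suc g_antimono[of r "r + 2 * m" "B m" m] Bm(1) by (intro add_mono) auto
  finally show ?case by (simp add: lessThan_Suc Un_commute)
qed

text \<open>\<open>B v\<close> is the group of terminals currently gathered at \<open>v\<close>, and
  \<open>\<phi>\<close> is the flow still to be routed. Removing a leaf takes two rounds and loses a
  vertex of the support, which gives the term with \<open>ends\<close>; the last
  \<open>2 * n\<close> rounds are for \<open>gather\<close>. The induction is on the number of
  edges, since cancelling a circulation may keep all vertices.\<close>

lemma route:
  assumes "\<And>e. 0 \<le> \<phi> e" "supp \<phi> \<subseteq> E" "\<And>v. v < n \<Longrightarrow> divergence n \<phi> v = sum sg (B v)"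
    and "\<And>v. v < n \<Longrightarrow> B v \<subseteq> U" "\<And>u v. u < n \<Longrightarrow> v < n \<Longrightarrow> u \<noteq> v \<Longrightarrow> B u \<inter> B v = {}"
  shows "g (r + 2 * card (ends (supp \<phi>)) + 2 * n) (\<Union>v<n. B v) 0
    \<le> (\<Sum>v<n. g r (B v) v) + sum w (supp \<phi>)"
  using assms
proof (induction "card (supp \<phi>)" arbitrary: \<phi> B r rule: less_induct)
  case less
  note [simp] = less.prems(1)
  have finE: "finite E" by (rule finite_subset[OF E]) simp
  have fin: "finite (supp \<phi>)" by (rule finite_subset[OF less.prems(2) finE])
  have ends_n: "ends (supp \<phi>) \<subseteq> {..<n}" using less.prems(2) E by (auto simp: ends_def)
  then have fin_ends: "finite (ends (supp \<phi>))" by (rule finite_subset) simp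
  have UB: "(\<Union>v<n. B v) \<subseteq> U" using less.prems(4) by blast
  show ?case
  proof (cases "\<exists>z. supp z \<subseteq> supp \<phi> \<and> supp z \<noteq> {} \<and> (\<forall>v<n. divergence n z v = 0)")
    case True
    then obtain z where z: "supp z \<subseteq> supp \<phi>" "supp z \<noteq> {}" "\<forall>v<n. divergence n z v = 0" by blast
    from cancel_circulation[OF fin less.prems(1) this] obtain \<psi> where
      \<psi>: "\<forall>e. 0 \<le> \<psi> e" "supp \<psi> \<subset> supp \<phi>" "\<forall>v<n. divergence n \<psi> v = divergence n \<phi> v"
      by blast
    have "card (ends (supp \<psi>)) \<le> card (ends (supp \<phi>))"
      using \<psi>(2) fin_ends by (intro card_mono) (auto simp: ends_def)
    then have "g (r + 2 * card (ends (supp \<phi>)) + 2 * n) (\<Union>v<n. B v) 0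
        \<le> g (r + 2 * card (ends (supp \<psi>)) + 2 * n) (\<Union>v<n. B v) 0"
      using UB n_pos by (intro g_antimono) auto
    also have "\<dots> \<le> (\<Sum>v<n. g r (B v) v) + sum w (supp \<psi>)"
      using \<psi> less.prems psubset_card_mono[OF fin \<psi>(2)] by (intro less.hyps) auto
    \<comment> \<open>The edges lost by the cancellation have nonnegative weight, so the smaller
      support is no dearer.\<close>
    also have "sum w (supp \<psi>) \<le> sum w (supp \<phi>)"
      using \<psi>(2) fin less.prems(2) w_nonneg by (intro sum_mono2) auto
    finally show ?thesis by simp
  next
    case no_circ: False
    show ?thesis
    proof (cases "supp \<phi> = {}")
      case True
      then have "divergence n \<phi> v = 0" for v by (simp add: divergence_eq_0 incident_def)
      then have "g (r + 2 * n) (\<Union>v<n. B v) 0 \<le> (\<Sum>v<n. g r (B v) v)"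
        using less.prems by (intro gather) auto
      then show ?thesis using True by (simp add: ends_def)
    next
      case False
      \<comment> \<open>Without a circulation the degree condition of
        \<open>circulation_exists\<close> must fail, so the support has a leaf.\<close>
      have "\<not> (\<forall>x\<in>ends (supp \<phi>). 2 \<le> card (incident (supp \<phi>) x))"
        using circulation_exists[of "supp \<phi>" n] no_circ False less.prems(2) E by blast
      then obtain x where x: "x \<in> ends (supp \<phi>)" "card (incident (supp \<phi>) x) < 2" by force
      have "finite (incident (supp \<phi>) x)" "incident (supp \<phi>) x \<noteq> {}"
        using x(1) fin unfolding incident_def ends_def by (simp, blast)
      with x(2) have "card (incident (supp \<phi>) x) = 1"
        by (metis One_nat_def card_0_eq less_2_cases)
      then obtain e where e: "incident (supp \<phi>) x = {e}" by (rule card_1_singletonE)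
      have "e \<in> incident (supp \<phi>) x" using e by simp
      then have eD: "e \<in> supp \<phi>" "e \<in> E" "fst e = x \<or> snd e = x" "fst e < n" "snd e < n"
        using less.prems(2) E by (auto simp: incident_def)
      \<comment> \<open>A loop has divergence zero everywhere and would be a circulation on its
        own.\<close>
      have not_loop: "fst e \<noteq> snd e"
      proof
        assume "fst e = snd e"
        then have "\<forall>v<n. divergence n (\<lambda>e'. if e' = e then 1 else 0) v = 0"
          using eD by (simp add: divergence_single)
        moreover have "supp (\<lambda>e'. if e' = e then 1 else 0) = {e}" by (auto simp: supp_def)
        ultimately show False using no_circ eD(1) by auto
      qed
      define y where "y = (if fst e = x then snd e else fst e)"
      have xy: "x < n" "y < n" "x \<noteq> y" using eD not_loop by (auto simp: y_def)
      \<comment> \<open>Dropping the leaf edge isolates \<open>x\<close>, so its divergence becomes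
        zero. Hence the imbalance of \<open>B x\<close> is plus or minus the flow on
        \<open>e\<close>, with the sign that permits moving along \<open>e\<close> towards
        \<open>y\<close>.\<close>
      define \<psi> where "\<psi> = (\<lambda>e'. \<phi> e' + (if e' = e then - \<phi> e else 0))"
      have supp\<psi>: "supp \<psi> = supp \<phi> - {e}" by (auto simp: supp_def \<psi>_def)
      have "incident (supp \<psi>) x = incident (supp \<phi>) x - {e}" by (auto simp: supp\<psi> incident_def)
      then have "incident (supp \<psi>) x = {}" using e by simp
      then have div_x: "divergence n \<psi> x = 0" by (rule divergence_eq_0)
      have div\<psi>: "divergence n \<psi> v
          = sum sg (B v) + ((if v = fst e then - \<phi> e else 0) - (if v = snd e then - \<phi> e else 0))"
        if "v < n" for v
        unfolding \<psi>_def divergence_add using eD less.prems(3) that by (simp add: divergence_single)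
      have "\<phi> e > 0" using eD(1) less.prems(1)[of e] by (simp add: supp_def less_le)
      have step: "g (Suc r) (B x) y \<le> g r (B x) x + w e"
      proof (cases "fst e = x")
        case True
        then have "sum sg (B x) = \<phi> e" using div\<psi>[of x] div_x xy not_loop by simp
        then show ?thesis
          using forward[of "B x" x y r] True eD \<open>\<phi> e > 0\<close> less.prems(4) xy by (cases e) (auto simp: y_def)
      next
        case False
        then have "sum sg (B x) = - \<phi> e" "snd e = x" using div\<psi>[of x] div_x xy eD by auto
        then show ?thesis
          using backward[of "B x" y x r] False eD \<open>\<phi> e > 0\<close> less.prems(4) xy by (cases e) (auto simp: y_def)
      qed
      \<comment> \<open>The group at the leaf crosses \<open>e\<close> as a whole in one round and
        joins the group at \<open>y\<close> in the next, so \<open>w e\<close> is paid once.\<close>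
      define B' where "B' = B(x := {}, y := B x \<union> B y)"
      have Bxy: "B x \<subseteq> U" "B y \<subseteq> U" "B x \<inter> B y = {}" using less.prems(4,5) xy by auto
      have finB: "finite (B x)" "finite (B y)" using Bxy finite_U by (auto intro: finite_subset)
      have UB': "(\<Union>v<n. B' v) = (\<Union>v<n. B v)"
        using xy by (auto simp: B'_def split: if_splits)
      have "sum sg (B' v) = divergence n \<psi> v" if "v < n" for v
      proof -
        consider "v = x" | "v = y" | "v \<noteq> x" "v \<noteq> y" by blast
        then show ?thesis
        proof cases
          case 1
          then show ?thesis using div_x xy by (simp add: B'_def)
        next
          case 2
          have "sum sg (B' y) = sum sg (B x) + sum sg (B y)"
            using Bxy finB by (simp add: B'_def sum.union_disjoint)
          moreover have "divergence n \<psi> y + divergence n \<psi> x = sum sg (B y) + sum sg (B x)"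
            using div\<psi>[of x] div\<psi>[of y] xy not_loop eD(3) by (auto simp: y_def split: if_splits)
          ultimately show ?thesis using 2 div_x by simp
        next
          case 3
          then show ?thesis using div\<psi>[OF that] eD(3) by (auto simp: B'_def y_def split: if_splits)
        qed
      qed
      note div_B' = this
      have "B' u \<inter> B' v = {}" if "u < n" "v < n" "u \<noteq> v" for u v
        using less.prems(5)[OF that] less.prems(5)[OF xy(1) that(1)] less.prems(5)[OF xy(1) that(2)]
          less.prems(5)[OF xy(2) that(1)] less.prems(5)[OF xy(2) that(2)] that
        unfolding B'_def by auto
      note disj' = this
      have B'U: "B' v \<subseteq> U" if "v < n" for v using less.prems(4) Bxy that by (auto simp: B'_def)
      have "x \<notin> ends (supp \<psi>)"
        using \<open>incident (supp \<psi>) x = {}\<close> unfolding ends_def incident_def by blast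
      moreover have "ends (supp \<psi>) \<subseteq> ends (supp \<phi>)" unfolding supp\<psi> ends_def by blast
      ultimately have "ends (supp \<psi>) \<subseteq> ends (supp \<phi>) - {x}" by blast
      then have "card (ends (supp \<psi>)) \<le> card (ends (supp \<phi>) - {x})"
        using fin_ends by (intro card_mono) auto
      then have "Suc (card (ends (supp \<psi>))) \<le> card (ends (supp \<phi>))"
        using fin_ends x(1) card_Suc_Diff1[of "ends (supp \<phi>)" x] by linarith
      then have "g (r + 2 * card (ends (supp \<phi>)) + 2 * n) (\<Union>v<n. B v) 0
          \<le> g (Suc (Suc r) + 2 * card (ends (supp \<psi>)) + 2 * n) (\<Union>v<n. B' v) 0"
        unfolding UB' using UB n_pos by (intro g_antimono) auto
      also have "\<dots> \<le> (\<Sum>v<n. g (Suc (Suc r)) (B' v) v) + sum w (supp \<psi>)"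
      proof (rule less.hyps)
        show "card (supp \<psi>) < card (supp \<phi>)"
          using eD(1) fin unfolding supp\<psi> by (intro psubset_card_mono) auto
      qed (use less.prems(2) supp\<psi> div_B' B'U disj' in \<open>auto simp: \<psi>_def\<close>)
      also have "(\<Sum>v<n. g (Suc (Suc r)) (B' v) v) \<le> (\<Sum>v<n. g r (B v) v) + w e"
      proof -
        have split: "(\<Sum>v<n. h v) = h x + h y + (\<Sum>v\<in>{..<n} - {x} - {y}. h v)" for h :: "nat \<Rightarrow> rat"
          using xy by (simp add: sum.remove[of "{..<n}" x] sum.remove[of "{..<n} - {x}" y])
        have "(\<Sum>v\<in>{..<n} - {x} - {y}. g (Suc (Suc r)) (B' v) v) \<le> (\<Sum>v\<in>{..<n} - {x} - {y}. g r (B v) v)"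
          using less.prems(4) by (intro sum_mono) (auto simp: B'_def intro!: g_antimono)
        moreover have "g (Suc (Suc r)) (B' x) x \<le> 0"
          using xy g_empty_le by (simp add: B'_def)
        moreover have "g (Suc (Suc r)) (B' y) y \<le> g r (B x) x + w e + g r (B y) y"
        proof -
          have "g (Suc (Suc r)) (B' y) y \<le> g (Suc r) (B x) y + g (Suc r) (B y) y"
            using merge[OF Bxy] xy by (simp add: B'_def)
          also have "\<dots> \<le> g r (B x) x + w e + g r (B y) y"
            using step g_Suc[OF Bxy(2) xy(2)] by (intro add_mono) auto
          finally show ?thesis .
        qed
        ultimately show ?thesis unfolding split by simp
      qed
      also have "(\<Sum>v<n. g r (B v) v) + w e + sum w (supp \<psi>) = (\<Sum>v<n. g r (B v) v) + sum w (supp \<phi>)"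
        using eD(1) fin by (simp add: supp\<psi> sum.remove)
      finally show ?thesis by simp
    qed
  qed
qed

text \<open>The rounds are spent as follows: \<open>card U\<close> for merging the terminals that
  start at a common vertex, at most \<open>2 * n\<close> for the leaves of the forest, and
  \<open>2 * n\<close> for the final gathering.\<close>

lemma below_flow_cost:
  assumes pos: "\<And>i. i \<in> U \<Longrightarrow> pos i < n" "\<And>i. i \<in> U \<Longrightarrow> g 0 {i} (pos i) \<le> 0"
    and \<phi>: "\<And>e. 0 \<le> \<phi> e" "supp \<phi> \<subseteq> E"
      "\<And>v. v < n \<Longrightarrow> divergence n \<phi> v = sum sg {i \<in> U. pos i = v}"
    and R: "card U + 4 * n \<le> R"
  shows "g R U 0 \<le> sum w (supp \<phi>)"
proof -
  define B where "B v = {i \<in> U. pos i = v}" for v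
  have "A \<subseteq> B v \<Longrightarrow> g (card A) A v \<le> 0" if "v < n" "finite A" for A v
    using that(2)
  proof (induction A rule: finite_induct)
    case empty
    then show ?case using that g_empty by simp
  next
    case (insert i A)
    then have i: "i \<in> U" "pos i = v" "A \<subseteq> U" by (auto simp: B_def)
    have "g (Suc (card A)) (insert i A) v \<le> g (card A) {i} v + g (card A) A v"
      using merge[of "{i}" A v "card A"] i insert.hyps that by simp
    also have "g (card A) {i} v \<le> g 0 {i} v" using i that by (intro g_antimono) auto
    finally show ?case using insert pos(2)[of i] i by simp
  qed
  then have B0: "g (card U) (B v) v \<le> 0" if "v < n" for v
  proof -
    have "card (B v) \<le> card U" "B v \<subseteq> U" "finite (B v)"
      using finite_U by (auto simp: B_def intro: card_mono)
    then show ?thesis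
      using \<open>\<And>v A. \<lbrakk>v < n; finite A; A \<subseteq> B v\<rbrakk> \<Longrightarrow> g (card A) A v \<le> 0\<close>[of v "B v"] that
        g_antimono[of "card (B v)" "card U" "B v" v] by force
  qed
  have UB: "(\<Union>v<n. B v) = U" using pos(1) by (auto simp: B_def)
  have "ends (supp \<phi>) \<subseteq> {..<n}" using \<phi>(2) E by (auto simp: ends_def)
  from card_mono[OF _ this] have "card (ends (supp \<phi>)) \<le> n" by simp
  then have "g R U 0 \<le> g (card U + 2 * card (ends (supp \<phi>)) + 2 * n) U 0"
    using R n_pos by (intro g_antimono) auto
  also have "\<dots> \<le> (\<Sum>v<n. g (card U) (B v) v) + sum w (supp \<phi>)"
    using route[of \<phi> B "card U"] \<phi> unfolding UB by (auto simp: B_def)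
  also have "(\<Sum>v<n. g (card U) (B v) v) \<le> 0"
    by (intro sum_nonpos B0) simp
  finally show ?thesis by simp
qed

end

section \<open>Multisets and binary codes of sets\<close>

lemma rel_mset_refl: "(\<And>x. x \<in># M \<Longrightarrow> R x x) \<Longrightarrow> rel_mset R M M"
  by (induction M) (auto intro: rel_mset_Plus rel_mset_Zero)

lemma rel_mset_trans:
  assumes "rel_mset R L M" "rel_mset S M P" "\<And>x y z. R x y \<Longrightarrow> S y z \<Longrightarrow> Q x z"
  shows "rel_mset Q L P"
proof -
  have "rel_mset (R OO S) L P" using assms(1,2) by (auto simp: multiset.rel_compp)
  then show ?thesis by (rule multiset.rel_mono_strong) (use assms(3) in blast)
qed

lemma rel_mset_union:
  assumes "rel_mset R M P" "rel_mset R M' P'"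
  shows "rel_mset R (M + M') (P + P')"
  using assms by induction (auto intro: rel_mset_Plus)

text \<open>If the left \<open>v\<close> is matched to \<open>b\<close> and some \<open>c\<close> is
  matched to the right \<open>v\<close>, transitivity allows \<open>c\<close> to be matched to
  \<open>b\<close> directly.\<close>

lemma rel_mset_cancel:
  assumes "transp R" "rel_mset R (add_mset v M) (add_mset v P)"
  shows "rel_mset R M P"
proof -
  obtain N1 b where N1: "add_mset v P = add_mset b N1" "R v b" "rel_mset R M N1"
    using msed_rel_invL[OF assms(2)] by blast
  show ?thesis
  proof (cases "b = v")
    case False
    with N1(1) obtain N2 where N2: "N1 = add_mset v N2" "P = add_mset b N2"
      by (auto simp: add_eq_conv_ex)
    obtain M1 c where M1: "M = add_mset c M1" "R c v" "rel_mset R M1 N2"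
      using msed_rel_invR[OF N1(3)[unfolded N2]] by blast
    then have "R c b" using N1(2) assms(1) by (blast dest: transpD)
    then show ?thesis using M1 N2 by (simp add: rel_mset_Plus)
  qed (use N1 in simp)
qed

lemma rel_mset_cancel_replicate:
  assumes "transp R" "rel_mset R (M + replicate_mset m v) (P + replicate_mset m v)"
  shows "rel_mset R M P"
  using assms(2) by (induction m) (auto dest: rel_mset_cancel[OF assms(1)])

lemma occs_add_mset: "occs (add_mset x M) = insert (x, count M x) (occs M)"
  by (auto simp: occs_def less_Suc_eq split: if_splits)

text \<open>Adding \<open>x\<close> to \<open>M\<close> creates exactly one new occurrence, tagged
  \<open>count M x\<close>, so a matching of multisets extends to a bijection of tagged occurrences
  one pair at a time.\<close>

lemma rel_mset_occs_bij:
  assumes "rel_mset R M P"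
  shows "\<exists>f. bij_betw f (occs M) (occs P) \<and> (\<forall>s\<in>occs M. R (fst s) (fst (f s)))"
  using assms
proof induction
  case empty
  then show ?case by (auto simp: occs_def bij_betw_def)
next
  case (add R x y M P)
  then obtain f where f: "bij_betw f (occs M) (occs P)" "\<forall>s\<in>occs M. R (fst s) (fst (f s))" by blast
  define f' where "f' = f((x, count M x) := (y, count P y))"
  have notin: "(x, count M x) \<notin> occs M" "(y, count P y) \<notin> occs P" by (auto simp: occs_def)
  have "bij_betw f' (occs M) (occs P)"
    using f(1) notin by (subst bij_betw_cong[of _ _ f]) (auto simp: f'_def)
  then have "bij_betw f' (occs (add_mset x M)) (occs (add_mset y P))"
    using notIn_Un_bij_betw[of "(x, count M x)" "occs M" f' "occs P"] notin unfolding occs_add_mset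
    by (simp add: f'_def Un_commute)
  moreover have "\<forall>s\<in>occs (add_mset x M). R (fst s) (fst (f' s))"
    using f(2) add.hyps by (auto simp: occs_add_mset f'_def)
  ultimately show ?case by blast
qed

lemma finite_occs [simp]: "finite (occs M)"
  by (induction M) (simp_all add: occs_add_mset, simp add: occs_def)

lemma sum_occs_eq_count: "(\<Sum>s\<in>occs M. if v = fst s then 1 else 0) = of_nat (count M v)"
proof (induction M)
  case (add x M)
  have "(x, count M x) \<notin> occs M" by (auto simp: occs_def)
  with add show ?case by (auto simp: occs_add_mset)
qed (simp add: occs_def)

text \<open>Summing one path flow per occurrence forgets the bijection and keeps only how many
  sources and targets lie at each vertex.\<close>

lemma bij_occs_flow:
  assumes "K \<subseteq> {..<n} \<times> {..<n}" "bij_betw f (occs M) (occs P)"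
    and "\<forall>s\<in>occs M. (fst s, fst (f s)) \<in> K\<^sup>*"
  shows "\<exists>\<phi>. (\<forall>e. 0 \<le> \<phi> e) \<and> supp \<phi> \<subseteq> K \<and>
    (\<forall>v. divergence n \<phi> v = of_nat (count M v) - of_nat (count P v))"
proof -
  have "\<exists>\<phi>. (\<forall>e. 0 \<le> \<phi> e) \<and> supp \<phi> \<subseteq> K \<and> (\<forall>v. divergence n \<phi> v
      = (if v = fst s then 1 else 0) - (if v = fst (f s) then 1 else 0))" if "s \<in> occs M" for s
    using rtrancl_flow assms(1,3) that by blast
  then obtain \<phi> where \<phi>: "\<And>s e. s \<in> occs M \<Longrightarrow> 0 \<le> \<phi> s e" "\<And>s. s \<in> occs M \<Longrightarrow> supp (\<phi> s) \<subseteq> K"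
    "\<And>s v. s \<in> occs M \<Longrightarrow> divergence n (\<phi> s) v
      = (if v = fst s then 1 else 0) - (if v = fst (f s) then 1 else 0)"
    by metis
  define \<psi> where "\<psi> e = (\<Sum>s\<in>occs M. \<phi> s e)" for e
  have "divergence n \<psi> v = of_nat (count M v) - of_nat (count P v)" for v
  proof -
    have "divergence n \<psi> v
        = (\<Sum>s\<in>occs M. (if v = fst s then 1 else 0) - (if v = fst (f s) then 1 else 0))"
      unfolding \<psi>_def by (simp add: divergence_sum \<phi>(3))
    also have "\<dots> = of_nat (count M v) - (\<Sum>s\<in>occs P. if v = fst s then 1 else 0)"
      by (simp add: sum_subtractf sum_occs_eq_count
          sum.reindex_bij_betw[OF assms(2), of "\<lambda>s. if v = fst s then 1 else 0"])
    finally show ?thesis by (simp add: sum_occs_eq_count)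
  qed
  moreover have "supp \<psi> \<subseteq> K"
  proof
    fix e assume "e \<in> supp \<psi>"
    then obtain s where "s \<in> occs M" "\<phi> s e \<noteq> 0"
      unfolding supp_def \<psi>_def by (auto elim: sum.not_neutral_contains_not_neutral)
    then show "e \<in> K" using \<phi>(2)[of s] by (auto simp: supp_def)
  qed
  moreover have "\<forall>e. 0 \<le> \<psi> e" by (auto simp: \<psi>_def intro: sum_nonneg \<phi>(1))
  ultimately show ?thesis by blast
qed

section \<open>Binary codes of sets and carries in addition\<close>

text \<open>Words admit only arithmetic. A table of this function decides both whether two codes are
  disjoint and in which direction a set is out of balance.\<close>

definition popcount :: "nat \<Rightarrow> nat" where
  "popcount X = card (set_decode X)"

lemma popcount_0 [simp]: "popcount 0 = 0"
  by (simp add: popcount_def)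

lemma set_decode_rec:
  "set_decode X = Suc ` set_decode (X div 2) \<union> (if odd X then {0} else {})"
proof (rule set_eqI)
  show "i \<in> set_decode X \<longleftrightarrow> i \<in> Suc ` set_decode (X div 2) \<union> (if odd X then {0} else {})" for i
    by (cases i) auto
qed

lemma popcount_rec: "popcount X = popcount (X div 2) + X mod 2"
proof -
  from set_decode_rec[of X] have "popcount X = card (Suc ` set_decode (X div 2) \<union> (if odd X then {0} else {}))"
    by (simp add: popcount_def)
  also have "\<dots> = card (Suc ` set_decode (X div 2)) + card (if odd X then {0::nat} else {})"
    by (rule card_Un_disjoint) auto
  finally show ?thesis by (auto simp: popcount_def card_image mod_2_eq_odd)
qed

lemma popcount_double: "popcount (2 * X) = popcount X" "popcount (Suc (2 * X)) = Suc (popcount X)"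
  by (simp_all add: popcount_rec[of "2 * X"] popcount_rec[of "Suc (2 * X)"])

text \<open>Each carry in the binary addition of \<open>X\<close> and \<open>Y\<close> decreases the number of ones.\<close>

lemma popcount_add:
  "popcount (X + Y) \<le> popcount X + popcount Y \<and>
   (popcount (X + Y) = popcount X + popcount Y \<longrightarrow>
     set_decode X \<inter> set_decode Y = {} \<and> set_decode (X + Y) = set_decode X \<union> set_decode Y)"
proof (induction "X + Y" arbitrary: X Y rule: less_induct)
  case less
  \<comment> \<open>Used when the two low bits carry: both ones vanish and the carry creates at most
    one, so the count drops strictly.\<close>
  have suc: "popcount (Suc Z) \<le> Suc (popcount Z)" for Z
  proof (induction Z rule: less_induct)
    case (less Z)
    show ?case
    proof (cases "even Z")
      case True
      then show ?thesis by (auto elim!: evenE simp: popcount_double)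
    next
      case False
      then obtain Z' where Z': "Z = 2 * Z' + 1" by (auto elim: oddE)
      then have "popcount (Suc Z) = popcount (Suc Z')"
        using popcount_double(1)[of "Suc Z'"] by simp
      then show ?thesis using less[of Z'] Z' by (simp add: popcount_double)
    qed
  qed
  show ?case
  proof (cases "X + Y = 0")
    case False
    define x y where "x = X div 2" and "y = Y div 2"
    have "x + y < X + Y" using False unfolding x_def y_def by linarith
    have IH: "popcount (x + y) \<le> popcount x + popcount y"
      "popcount (x + y) = popcount x + popcount y \<Longrightarrow>
        set_decode x \<inter> set_decode y = {} \<and> set_decode (x + y) = set_decode x \<union> set_decode y"
      using less[of x y] \<open>x + y < X + Y\<close> by auto
    show ?thesis
    proof (cases "odd X \<and> odd Y")
      case True
      then have "X = Suc (2 * x)" "Y = Suc (2 * y)" by (auto simp: x_def y_def)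
      then have "popcount (X + Y) = popcount (Suc (x + y))" "popcount X = Suc (popcount x)"
          "popcount Y = Suc (popcount y)"
        using popcount_double(1)[of "Suc (x + y)"] by (simp_all add: popcount_double)
      then show ?thesis using IH(1) suc[of "x + y"] by simp
    next
      case False
      then have div: "(X + Y) div 2 = x + y" and mod: "(X + Y) mod 2 = X mod 2 + Y mod 2"
        unfolding x_def y_def by presburger+
      have pop: "popcount (X + Y) = popcount (x + y) + (X mod 2 + Y mod 2)"
        "popcount X = popcount x + X mod 2" "popcount Y = popcount y + Y mod 2"
        using popcount_rec[of "X + Y"] popcount_rec[of X] popcount_rec[of Y] div mod
        by (simp_all add: x_def y_def)
      have "set_decode X \<inter> set_decode Y = {} \<and> set_decode (X + Y) = set_decode X \<union> set_decode Y"
        if "popcount (X + Y) = popcount X + popcount Y"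
      proof -
        have "set_decode x \<inter> set_decode y = {}" "set_decode (x + y) = set_decode x \<union> set_decode y"
          using IH(2) pop that by auto
        then show ?thesis
          unfolding set_decode_rec[of X] set_decode_rec[of Y] set_decode_rec[of "X + Y"] div x_def[symmetric] y_def[symmetric]
          using False by auto
      qed
      then show ?thesis using pop IH(1) by simp
    qed
  qed simp
qed

lemma set_encode_Un_disjoint:
  "finite A \<Longrightarrow> finite B \<Longrightarrow> A \<inter> B = {} \<Longrightarrow> set_encode (A \<union> B) = set_encode A + set_encode B"
  by (simp add: set_encode_def sum.union_disjoint)

lemma popcount_set_encode: "finite A \<Longrightarrow> popcount (set_encode A) = card A"
  by (simp add: popcount_def)

lemma set_decode_div_power: "i \<in> set_decode (X div 2 ^ k) \<longleftrightarrow> k + i \<in> set_decode X"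
  by (simp add: set_decode_def div_mult2_eq[symmetric] power_add)

lemma set_decode_mod_power: "i \<in> set_decode (X mod 2 ^ k) \<longleftrightarrow> i < k \<and> i \<in> set_decode X"
  using bit_take_bit_iff[of k X i] by (simp add: set_decode_def bit_iff_odd take_bit_eq_mod)

lemma set_decode_bounded_iff: "set_decode X \<subseteq> {..<m} \<longleftrightarrow> X < 2 ^ m"
proof
  assume "set_decode X \<subseteq> {..<m}"
  then have "set_decode (X mod 2 ^ m) = set_decode X" by (auto simp: set_decode_mod_power)
  then have "X mod 2 ^ m = X" by (metis set_decode_inverse)
  then show "X < 2 ^ m" by (metis mod_less_divisor pos2 zero_less_power)
next
  assume "X < 2 ^ m"
  then have "X mod 2 ^ m = X" by simp
  then show "set_decode X \<subseteq> {..<m}" using set_decode_mod_power[of _ X m] by auto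
qed

section \<open>The table of the dynamic programme\<close>

lemma replicate_mset_plus: "replicate_mset (a + b) x = replicate_mset a x + replicate_mset b x"
  by (induction a) auto

lemma sum_lessThan_add: "sum h {..<a + b} = sum h {..<a} + (\<Sum>i<b. h (a + i))"
  for h :: "nat \<Rightarrow> 'a::comm_monoid_add"
  by (induction b) (simp_all add: add.assoc)

definition relax :: "nat \<Rightarrow> rat \<Rightarrow> (nat \<Rightarrow> rat) \<Rightarrow> nat \<Rightarrow> rat" where
  "relax i q F = (if q < F i then F(i := q) else F)"

lemma relax_le: "relax i q F j \<le> F j"
  by (simp add: relax_def)

lemma relax_target_le: "relax i q F i \<le> q"
  by (simp add: relax_def)

text \<open>The budget is nonnegative here because the program rejects a negative one before it
  builds any table.\<close>

locale routing =
  fixes n k :: nat and E :: "(nat \<times> nat) set" and w :: "nat \<times> nat \<Rightarrow> rat"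
    and xs ys :: "nat list" and l :: rat
  assumes n_pos: "0 < n" and E: "E \<subseteq> {..<n} \<times> {..<n}" and w_nonneg: "e \<in> E \<Longrightarrow> 0 \<le> w e"
    and len: "length xs = k" "length ys = k"
    and xs_n: "set xs \<subseteq> {..<n}" and ys_n: "set ys \<subseteq> {..<n}" and l_nonneg: "0 \<le> l"
begin

definition m :: nat where "m = 2 ^ k * 2 ^ k"

lemma m_power: "m = 2 ^ (k + k)"
  unfolding m_def power_add ..

lemma m_pos [simp]: "0 < m"
  by (simp add: m_def)

text \<open>
  Cell \<open>X * n + v\<close> is the entry for the set of terminals with binary code \<open>X\<close>, gathered at the
  vertex \<open>v\<close>; source \<open>i\<close> is bit \<open>i\<close> and target \<open>i\<close> is bit \<open>k + i\<close>.
\<close>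

definition step :: "nat \<Rightarrow> (nat \<Rightarrow> rat) \<Rightarrow> nat \<Rightarrow> rat" where
  "step z F =
    (let X = z mod m; Y = z div m mod m; u = z div m div m mod n; v = z div m div m div n mod n;
         F1 = (if popcount (X + Y) < popcount X + popcount Y then F
               else relax ((X + Y) * n + u) (F (X * n + u) + F (Y * n + u)) F)
     in if popcount (X div 2 ^ k) < popcount (X mod 2 ^ k)
        then (if (u, v) \<in> E then relax (X * n + v) (F1 (X * n + u) + w (u, v)) F1 else F1)
        else if popcount (X mod 2 ^ k) < popcount (X div 2 ^ k)
        then (if (u, v) \<in> E then relax (X * n + u) (F1 (X * n + v) + w (u, v)) F1 else F1)
        else relax (X * n + v) (F1 (X * n + u)) F1)"

primrec iter :: "nat \<Rightarrow> (nat \<Rightarrow> rat) \<Rightarrow> nat \<Rightarrow> rat" where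
  "iter 0 F = F"
| "iter (Suc z) F = step z (iter z F)"

text \<open>Weights have no infinity; \<open>l + 1\<close> takes its place, being above the
  budget.\<close>

definition initial :: "(nat \<Rightarrow> rat) \<Rightarrow> bool" where
  "initial F \<longleftrightarrow> (\<forall>X<m. \<forall>v<n. F (X * n + v) =
     (if X = 0 \<or> (\<exists>i<k. X = 2 ^ i \<and> v = xs ! i \<or> X = 2 ^ k * 2 ^ i \<and> v = ys ! i) then 0 else l + 1))"

definition srcs :: "nat \<Rightarrow> nat multiset" where
  "srcs X = image_mset ((!) xs) (mset_set {i. i < k \<and> i \<in> set_decode X})"

definition tgts :: "nat \<Rightarrow> nat multiset" where
  "tgts X = image_mset ((!) ys) (mset_set {i. i < k \<and> k + i \<in> set_decode X})"

text \<open>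
  The \<open>a\<close> copies of \<open>v\<close> supply and the \<open>b\<close> copies absorb the imbalance of \<open>X\<close>. Only \<open>a - b\<close> matters:
  common copies cancel by transitivity of reachability.
\<close>

definition serves :: "nat \<Rightarrow> nat \<Rightarrow> (nat \<times> nat) set \<Rightarrow> bool" where
  "serves X v K \<longleftrightarrow> (\<exists>a b. rel_mset (\<lambda>x y. (x, y) \<in> K\<^sup>*)
     (srcs X + replicate_mset a v) (tgts X + replicate_mset b v))"

text \<open>Entries above \<open>l\<close> carry no certificate. They must still be nonnegative, so
  that a sum within the budget has both summands within the budget.\<close>

definition sound :: "(nat \<Rightarrow> rat) \<Rightarrow> bool" where
  "sound F \<longleftrightarrow> (\<forall>X<m. \<forall>v<n. 0 \<le> F (X * n + v) \<and>
     (F (X * n + v) \<le> l \<longrightarrow> (\<exists>K\<subseteq>E. sum w K \<le> F (X * n + v) \<and> serves X v K)))"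

lemma finite_E: "finite E"
  by (rule finite_subset[OF E]) simp

lemma cell_inj:
  assumes "u < n" "v < n"
  shows "X * n + u = Y * n + v \<longleftrightarrow> X = Y \<and> u = v"
proof -
  have "(X * n + u) div n = X" "(X * n + u) mod n = u" "(Y * n + v) div n = Y" "(Y * n + v) mod n = v"
    using assms by simp_all
  then show ?thesis by metis
qed

lemma set_decode_less_m: "X < m \<longleftrightarrow> set_decode X \<subseteq> {..<k + k}"
  by (simp add: m_power set_decode_bounded_iff)

lemma size_srcs: "size (srcs X) = popcount (X mod 2 ^ k)"
  by (auto simp: srcs_def popcount_def set_decode_mod_power intro!: arg_cong[of _ _ card])

lemma size_tgts: "X < m \<Longrightarrow> size (tgts X) = popcount (X div 2 ^ k)"
  by (auto simp: tgts_def popcount_def set_decode_div_power set_decode_less_m intro!: arg_cong[of _ _ card])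

section \<open>Soundness: edge sets that certify the entries\<close>

lemma rel_mset_rtrancl_mono:
  "K \<subseteq> L \<Longrightarrow> rel_mset (\<lambda>x y. (x, y) \<in> K\<^sup>*) M P \<Longrightarrow> rel_mset (\<lambda>x y. (x, y) \<in> L\<^sup>*) M P"
  by (erule multiset.rel_mono_strong) (metis rtrancl_mono subsetD)

lemma transp_rtrancl: "transp (\<lambda>x y. (x, y) \<in> K\<^sup>*)"
  by (auto intro: transpI)

text \<open>Disjoint codes split both terminal multisets into sums, so the two matchings stand side
  by side. Copies of \<open>v\<close> accumulate on both sides; where a surplus meets a deficit they
  can be cancelled afterwards.\<close>

lemma serves_merge:
  assumes "serves X v K" "serves Y v L"
    and disj: "set_decode X \<inter> set_decode Y = {}" "set_decode (X + Y) = set_decode X \<union> set_decode Y"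
  shows "serves (X + Y) v (K \<union> L)"
proof -
  obtain a b c d where
    *: "rel_mset (\<lambda>x y. (x, y) \<in> K\<^sup>*) (srcs X + replicate_mset a v) (tgts X + replicate_mset b v)"
      "rel_mset (\<lambda>x y. (x, y) \<in> L\<^sup>*) (srcs Y + replicate_mset c v) (tgts Y + replicate_mset d v)"
    using assms(1,2) by (auto simp: serves_def)
  have "rel_mset (\<lambda>x y. (x, y) \<in> (K \<union> L)\<^sup>*)
      (srcs X + replicate_mset a v + (srcs Y + replicate_mset c v))
      (tgts X + replicate_mset b v + (tgts Y + replicate_mset d v))"
    by (rule rel_mset_union[OF rel_mset_rtrancl_mono[OF Un_upper1 *(1)] rel_mset_rtrancl_mono[OF Un_upper2 *(2)]])
  moreover have "mset_set {i. i < k \<and> i \<in> set_decode (X + Y)}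
      = mset_set {i. i < k \<and> i \<in> set_decode X} + mset_set {i. i < k \<and> i \<in> set_decode Y}"
    using disj by (subst mset_set_Union[symmetric]) (auto intro!: arg_cong[of _ _ mset_set])
  then have "srcs (X + Y) = srcs X + srcs Y" by (simp add: srcs_def)
  moreover have "mset_set {i. i < k \<and> k + i \<in> set_decode (X + Y)}
      = mset_set {i. i < k \<and> k + i \<in> set_decode X} + mset_set {i. i < k \<and> k + i \<in> set_decode Y}"
    using disj by (subst mset_set_Union[symmetric]) (auto intro!: arg_cong[of _ _ mset_set])
  then have "tgts (X + Y) = tgts X + tgts Y" by (simp add: tgts_def)
  ultimately show ?thesis unfolding serves_def
    by (intro exI[of _ "a + c"] exI[of _ "b + d"]) (simp add: replicate_mset_plus ac_simps)
qed

text \<open>A matching preserves sizes, so \<open>b\<close> exceeds \<open>a\<close> by exactly the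
  surplus. Cancelling the common copies leaves a normal form in which \<open>v\<close> only
  absorbs.\<close>

lemma serves_surplus:
  assumes "serves X v K" "size (tgts X) \<le> size (srcs X)"
  shows "rel_mset (\<lambda>x y. (x, y) \<in> K\<^sup>*) (srcs X)
    (tgts X + replicate_mset (size (srcs X) - size (tgts X)) v)"
proof -
  obtain a b where ab:
    "rel_mset (\<lambda>x y. (x, y) \<in> K\<^sup>*) (srcs X + replicate_mset a v) (tgts X + replicate_mset b v)"
    using assms(1) by (auto simp: serves_def)
  from rel_mset_size[OF this] assms(2) have "b = (size (srcs X) - size (tgts X)) + a" by simp
  with ab have "rel_mset (\<lambda>x y. (x, y) \<in> K\<^sup>*) (srcs X + replicate_mset a v)
      (tgts X + replicate_mset (size (srcs X) - size (tgts X)) v + replicate_mset a v)"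
    by (simp add: replicate_mset_plus ac_simps)
  then show ?thesis by (rule rel_mset_cancel_replicate[OF transp_rtrancl])
qed

lemma serves_deficit:
  assumes "serves X v K" "size (srcs X) \<le> size (tgts X)"
  shows "rel_mset (\<lambda>x y. (x, y) \<in> K\<^sup>*)
    (srcs X + replicate_mset (size (tgts X) - size (srcs X)) v) (tgts X)"
proof -
  obtain a b where ab:
    "rel_mset (\<lambda>x y. (x, y) \<in> K\<^sup>*) (srcs X + replicate_mset a v) (tgts X + replicate_mset b v)"
    using assms(1) by (auto simp: serves_def)
  from rel_mset_size[OF this] assms(2) have "a = (size (tgts X) - size (srcs X)) + b" by simp
  with ab have "rel_mset (\<lambda>x y. (x, y) \<in> K\<^sup>*)
      (srcs X + replicate_mset (size (tgts X) - size (srcs X)) v + replicate_mset b v)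
      (tgts X + replicate_mset b v)"
    by (simp add: replicate_mset_plus ac_simps)
  then show ?thesis by (rule rel_mset_cancel_replicate[OF transp_rtrancl])
qed

lemma rel_mset_replicate: "R u v \<Longrightarrow> rel_mset R (replicate_mset a u) (replicate_mset a v)"
  by (induction a) (auto intro: rel_mset_Plus rel_mset_Zero)

text \<open>In the normal form all surplus paths end at \<open>u\<close>, so the single edge
  \<open>(u, v)\<close> extends every one of them.\<close>

lemma serves_forward:
  assumes "serves X u K" "size (tgts X) \<le> size (srcs X)"
  shows "serves X v (insert (u, v) K)"
proof -
  let ?a = "size (srcs X) - size (tgts X)"
  have *: "rel_mset (\<lambda>x y. (x, y) \<in> (insert (u, v) K)\<^sup>*) (tgts X + replicate_mset ?a u) (tgts X + replicate_mset ?a v)"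
    by (intro rel_mset_union rel_mset_refl rel_mset_replicate) auto
  have "rel_mset (\<lambda>x y. (x, y) \<in> (insert (u, v) K)\<^sup>*) (srcs X) (tgts X + replicate_mset ?a v)"
    by (rule rel_mset_trans[OF rel_mset_rtrancl_mono[OF subset_insertI serves_surplus[OF assms]] *]) (rule rtrancl_trans)
  then show ?thesis unfolding serves_def by (intro exI[of _ 0] exI[of _ ?a]) simp
qed

lemma serves_backward:
  assumes "serves X v K" "size (srcs X) \<le> size (tgts X)"
  shows "serves X u (insert (u, v) K)"
proof -
  let ?a = "size (tgts X) - size (srcs X)"
  have *: "rel_mset (\<lambda>x y. (x, y) \<in> (insert (u, v) K)\<^sup>*) (srcs X + replicate_mset ?a u) (srcs X + replicate_mset ?a v)"
    by (intro rel_mset_union rel_mset_refl rel_mset_replicate) auto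
  have "rel_mset (\<lambda>x y. (x, y) \<in> (insert (u, v) K)\<^sup>*) (srcs X + replicate_mset ?a u) (tgts X)"
    by (rule rel_mset_trans[OF * rel_mset_rtrancl_mono[OF subset_insertI serves_deficit[OF assms]]]) (rule rtrancl_trans)
  then show ?thesis unfolding serves_def by (intro exI[of _ ?a] exI[of _ 0]) simp
qed

text \<open>The normal form of a balanced set contains no copy of its vertex.\<close>

lemma serves_jump:
  assumes "serves X u K" "size (srcs X) = size (tgts X)"
  shows "serves X v K"
  using serves_surplus[OF assms(1)] assms(2) unfolding serves_def
  by (intro exI[of _ 0]) simp

text \<open>Common edges are counted twice on the right; nonnegative weights turn this into an
  inequality.\<close>

lemma sum_w_Un: "K \<subseteq> E \<Longrightarrow> L \<subseteq> E \<Longrightarrow> sum w (K \<union> L) \<le> sum w K + sum w L"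
  using sum.union_inter[of K L w] sum_nonneg[of "K \<inter> L" w] w_nonneg finite_subset[OF _ finite_E]
  by (smt (verit, best) IntD1 le_add_same_cancel1 subsetD)

lemma sound_nonneg: "sound F \<Longrightarrow> X < m \<Longrightarrow> v < n \<Longrightarrow> 0 \<le> F (X * n + v)"
  by (simp add: sound_def)

lemma soundD: "sound F \<Longrightarrow> X < m \<Longrightarrow> v < n \<Longrightarrow> F (X * n + v) \<le> l \<Longrightarrow>
    \<exists>K\<subseteq>E. sum w K \<le> F (X * n + v) \<and> serves X v K"
  by (simp add: sound_def)

lemma sound_relax:
  assumes "sound F" "v < n" "0 \<le> q" "q \<le> l \<Longrightarrow> \<exists>K\<subseteq>E. sum w K \<le> q \<and> serves X v K"
  shows "sound (relax (X * n + v) q F)"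
  using assms unfolding sound_def by (auto simp: relax_def cell_inj)

lemma sound_relax_edge:
  assumes "sound F" "X < m" "u < n" "v < n" "e \<in> E"
    and "\<And>K. serves X u K \<Longrightarrow> serves X v (insert e K)"
  shows "sound (relax (X * n + v) (F (X * n + u) + w e) F)"
proof (rule sound_relax[OF assms(1,4)])
  show "0 \<le> F (X * n + u) + w e" using sound_nonneg[OF assms(1-3)] w_nonneg[OF assms(5)] by simp
  assume "F (X * n + u) + w e \<le> l"
  then have "F (X * n + u) \<le> l" using w_nonneg[OF assms(5)] by simp
  from soundD[OF assms(1-3) this] obtain K where
    K: "K \<subseteq> E" "sum w K \<le> F (X * n + u)" "serves X u K" by blast
  have "sum w (insert e K) \<le> F (X * n + u) + w e"
    using sum_w_Un[of K "{e}"] K assms(5) by simp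
  then show "\<exists>K\<subseteq>E. sum w K \<le> F (X * n + u) + w e \<and> serves X v K"
    using K assms(5,6) by (intro exI[of _ "insert e K"]) auto
qed

text \<open>By nonnegativity both summands are within the budget once their sum is, so both have
  certificates; the test on the numbers of ones excludes overlapping sets.\<close>

lemma sound_relax_merge:
  assumes "sound F" "X < m" "Y < m" "u < n" "\<not> popcount (X + Y) < popcount X + popcount Y"
  shows "sound (relax ((X + Y) * n + u) (F (X * n + u) + F (Y * n + u)) F)"
proof (rule sound_relax[OF assms(1,4)])
  show "0 \<le> F (X * n + u) + F (Y * n + u)"
    using sound_nonneg[OF assms(1,2,4)] sound_nonneg[OF assms(1,3,4)] by simp
  assume "F (X * n + u) + F (Y * n + u) \<le> l"
  then have "F (X * n + u) \<le> l" "F (Y * n + u) \<le> l"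
    using sound_nonneg[OF assms(1,2,4)] sound_nonneg[OF assms(1,3,4)] by simp_all
  with soundD[OF assms(1,2,4)] soundD[OF assms(1,3,4)] obtain K L where
    K: "K \<subseteq> E" "sum w K \<le> F (X * n + u)" "serves X u K" and
    L: "L \<subseteq> E" "sum w L \<le> F (Y * n + u)" "serves Y u L" by blast
  have "set_decode X \<inter> set_decode Y = {}" "set_decode (X + Y) = set_decode X \<union> set_decode Y"
    using popcount_add[of X Y] assms(5) by auto
  then have "serves (X + Y) u (K \<union> L)" using K L by (intro serves_merge)
  moreover have "sum w (K \<union> L) \<le> F (X * n + u) + F (Y * n + u)"
    using sum_w_Un[of K L] K L by simp
  ultimately show "\<exists>K\<subseteq>E. sum w K \<le> F (X * n + u) + F (Y * n + u) \<and> serves (X + Y) u K"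
    using K L by (intro exI[of _ "K \<union> L"]) auto
qed

lemma sound_step:
  assumes "sound F"
  shows "sound (step z F)"
proof -
  define X where "X = z mod m"
  define Y where "Y = z div m mod m"
  define u where "u = z div m div m mod n"
  define v where "v = z div m div m div n mod n"
  define F1 where "F1 = (if popcount (X + Y) < popcount X + popcount Y then F
    else relax ((X + Y) * n + u) (F (X * n + u) + F (Y * n + u)) F)"
  have bounds: "X < m" "Y < m" "u < n" "v < n" using n_pos by (simp_all add: X_def Y_def u_def v_def)
  have F1: "sound F1" using assms bounds sound_relax_merge by (simp add: F1_def)
  note sizes = size_srcs size_tgts[OF bounds(1)]
  have "sound (relax (X * n + v) (F1 (X * n + u) + w (u, v)) F1)"
    if "(u, v) \<in> E" "popcount (X div 2 ^ k) < popcount (X mod 2 ^ k)"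
    using that bounds F1 by (intro sound_relax_edge serves_forward) (auto simp: sizes)
  moreover have "sound (relax (X * n + u) (F1 (X * n + v) + w (u, v)) F1)"
    if "(u, v) \<in> E" "popcount (X mod 2 ^ k) < popcount (X div 2 ^ k)"
    using that bounds F1 by (intro sound_relax_edge serves_backward) (auto simp: sizes)
  moreover have "sound (relax (X * n + v) (F1 (X * n + u)) F1)"
    if "popcount (X mod 2 ^ k) = popcount (X div 2 ^ k)"
  proof (rule sound_relax[OF F1 bounds(4) sound_nonneg[OF F1 bounds(1,3)]])
    assume "F1 (X * n + u) \<le> l"
    from soundD[OF F1 bounds(1,3) this] show "\<exists>K\<subseteq>E. sum w K \<le> F1 (X * n + u) \<and> serves X v K"
      using serves_jump[of X u _ v] that by (auto simp: sizes)
  qed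
  ultimately show ?thesis using F1
    unfolding step_def Let_def X_def[symmetric] Y_def[symmetric] u_def[symmetric] v_def[symmetric]
      F1_def[symmetric]
    by auto
qed

lemma set_decode_power [simp]: "set_decode (2 ^ i) = {i}"
  using set_encode_inverse[of "{i}"] by (simp add: set_encode_def)

text \<open>The empty edge set certifies the zero entries: a lone source is absorbed by a copy of
  its own vertex, and a lone target is supplied by one.\<close>

lemma sound_initial:
  assumes "initial F"
  shows "sound F"
  unfolding sound_def
proof (intro allI impI)
  fix X v assume X: "X < m" and v: "v < n"
  let ?c = "X = 0 \<or> (\<exists>i<k. X = 2 ^ i \<and> v = xs ! i \<or> X = 2 ^ k * 2 ^ i \<and> v = ys ! i)"
  have F: "F (X * n + v) = (if ?c then 0 else l + 1)" using assms X v by (simp add: initial_def)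
  have "serves X v {}" if ?c
    using that
  proof (elim disjE exE conjE)
    assume "X = 0"
    then show ?thesis unfolding serves_def
      by (intro exI[of _ 0]) (simp add: srcs_def tgts_def rel_mset_Zero)
  next
    fix i assume i: "i < k" "X = 2 ^ i" "v = xs ! i"
    then have codes: "{j. j < k \<and> j \<in> set_decode X} = {i}" "{j. j < k \<and> k + j \<in> set_decode X} = {}"
      by auto
    have "srcs X = {#v#}" "tgts X = {#}" using i(3) unfolding srcs_def tgts_def codes by simp_all
    then show ?thesis unfolding serves_def
      by (intro exI[of _ 0] exI[of _ 1]) (simp add: rel_mset_Plus rel_mset_Zero)
  next
    fix i assume i: "i < k" "X = 2 ^ k * 2 ^ i" "v = ys ! i"
    then have "X = 2 ^ (k + i)" by (simp add: power_add)
    then have codes: "{j. j < k \<and> j \<in> set_decode X} = {}" "{j. j < k \<and> k + j \<in> set_decode X} = {i}"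
      using i(1) by auto
    have "srcs X = {#}" "tgts X = {#v#}" using i(3) unfolding srcs_def tgts_def codes by simp_all
    then show ?thesis unfolding serves_def
      by (intro exI[of _ 1] exI[of _ 0]) (simp add: rel_mset_Plus rel_mset_Zero)
  qed
  then show "0 \<le> F (X * n + v) \<and>
      (F (X * n + v) \<le> l \<longrightarrow> (\<exists>K\<subseteq>E. sum w K \<le> F (X * n + v) \<and> serves X v K))"
    using F l_nonneg by (auto intro!: exI[of _ "{}"])
qed

lemma sound_iter: "initial F \<Longrightarrow> sound (iter z F)"
  by (induction z) (auto intro: sound_step sound_initial)

section \<open>Completeness: upper bounds on the entries after each round\<close>

lemma step_le: "step z F j \<le> F j"
  unfolding step_def Let_def by (auto intro: order_trans[OF relax_le] relax_le)

lemma iter_antimono: "z \<le> z' \<Longrightarrow> iter z' F j \<le> iter z F j"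
  by (induction z' rule: dec_induct) (auto intro: order_trans[OF step_le])

text \<open>A step merges first, so its move reads the table \<open>F1\<close>. Relaxing only lowers
  entries, hence the bounds hold in terms of \<open>F\<close> as well.\<close>

lemma step_target:
  assumes "X < m" "Y < m" "u < n" "v < n" "z = X + m * (Y + m * (u + n * (v + n * r)))"
  shows "set_decode X \<inter> set_decode Y = {} \<Longrightarrow> step z F ((X + Y) * n + u) \<le> F (X * n + u) + F (Y * n + u)"
    and "(u, v) \<in> E \<Longrightarrow> popcount (X div 2 ^ k) < popcount (X mod 2 ^ k) \<Longrightarrow>
      step z F (X * n + v) \<le> F (X * n + u) + w (u, v)"
    and "(u, v) \<in> E \<Longrightarrow> popcount (X mod 2 ^ k) < popcount (X div 2 ^ k) \<Longrightarrow>
      step z F (X * n + u) \<le> F (X * n + v) + w (u, v)"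
    and "popcount (X mod 2 ^ k) = popcount (X div 2 ^ k) \<Longrightarrow> step z F (X * n + v) \<le> F (X * n + u)"
proof -
  have "z mod m = X" "z div m = Y + m * (u + n * (v + n * r))" using assms by simp_all
  moreover have "(Y + m * (u + n * (v + n * r))) mod m = Y"
    "(Y + m * (u + n * (v + n * r))) div m = u + n * (v + n * r)" using assms by simp_all
  moreover have "(u + n * (v + n * r)) mod n = u" "(u + n * (v + n * r)) div n = v + n * r"
    "(v + n * r) mod n = v" using assms n_pos by simp_all
  ultimately have dec: "z mod m = X" "z div m mod m = Y" "z div m div m mod n = u"
    "z div m div m div n mod n = v" by simp_all
  define F1 where "F1 = (if popcount (X + Y) < popcount X + popcount Y then F
    else relax ((X + Y) * n + u) (F (X * n + u) + F (Y * n + u)) F)"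
  have step: "step z F =
    (if popcount (X div 2 ^ k) < popcount (X mod 2 ^ k)
     then (if (u, v) \<in> E then relax (X * n + v) (F1 (X * n + u) + w (u, v)) F1 else F1)
     else if popcount (X mod 2 ^ k) < popcount (X div 2 ^ k)
     then (if (u, v) \<in> E then relax (X * n + u) (F1 (X * n + v) + w (u, v)) F1 else F1)
     else relax (X * n + v) (F1 (X * n + u)) F1)"
    unfolding step_def dec Let_def F1_def ..
  have F1: "F1 j \<le> F j" for j by (simp add: F1_def relax_le)
  have le_F1: "step z F j \<le> F1 j" for j unfolding step by (simp add: relax_le)
  show "step z F ((X + Y) * n + u) \<le> F (X * n + u) + F (Y * n + u)"
    if "set_decode X \<inter> set_decode Y = {}"
  proof -
    \<comment> \<open>Disjoint codes add without a carry, so the test on the numbers of ones lets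
      the merge through.\<close>
    have "X + Y = set_encode (set_decode X \<union> set_decode Y)"
      using set_encode_Un_disjoint[OF _ _ that] by simp
    then have "popcount (X + Y) = card (set_decode X \<union> set_decode Y)" by (simp add: popcount_set_encode)
    also have "\<dots> = popcount X + popcount Y" using that by (simp add: popcount_def card_Un_disjoint)
    finally have "F1 ((X + Y) * n + u) \<le> F (X * n + u) + F (Y * n + u)"
      by (simp add: F1_def relax_target_le)
    then show ?thesis using le_F1 by (rule order_trans[rotated])
  qed
  show "step z F (X * n + v) \<le> F (X * n + u) + w (u, v)"
    if "(u, v) \<in> E" "popcount (X div 2 ^ k) < popcount (X mod 2 ^ k)"
    using relax_target_le[of "X * n + v" "F1 (X * n + u) + w (u, v)" F1] F1[of "X * n + u"] that
    unfolding step by simp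
  show "step z F (X * n + u) \<le> F (X * n + v) + w (u, v)"
    if "(u, v) \<in> E" "popcount (X mod 2 ^ k) < popcount (X div 2 ^ k)"
    using relax_target_le[of "X * n + u" "F1 (X * n + v) + w (u, v)" F1] F1[of "X * n + v"] that
    unfolding step by simp
  show "step z F (X * n + v) \<le> F (X * n + u)" if "popcount (X mod 2 ^ k) = popcount (X div 2 ^ k)"
    using relax_target_le[of "X * n + v" "F1 (X * n + u)" F1] F1[of "X * n + u"] that
    unfolding step by simp
qed

text \<open>The counter is read in mixed radix with digits \<open>X\<close>, \<open>Y\<close>,
  \<open>u\<close>, \<open>v\<close>; the quotient above the fourth digit is the number of the
  round.\<close>

definition round_length :: nat where "round_length = m * m * n * n"

lemma step_in_round:
  assumes "X < m" "Y < m" "u < n" "v < n" "z = X + m * (Y + m * (u + n * (v + n * r)))"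
  shows "r * round_length \<le> z" "Suc z \<le> Suc r * round_length"
proof -
  have "z = (X + m * (Y + m * (u + n * v))) + r * round_length"
    using assms(5) by (simp add: round_length_def algebra_simps)
  moreover have "u + n * v < n * n" "Y + m * (u + n * v) < m * (n * n)"
    "X + m * (Y + m * (u + n * v)) < m * (m * (n * n))"
  proof -
    \<comment> \<open>The bound gained by putting one more digit below a mixed radix number.\<close>
    have pair: "a + b * c < b * d" if "a < b" "c < d" for a b c d :: nat
    proof -
      have "a + b * c < b * Suc c" using that by simp
      also have "\<dots> \<le> b * d" using that by (intro mult_le_mono) auto
      finally show ?thesis .
    qed
    show 1: "u + n * v < n * n" using assms by (intro pair)
    show 2: "Y + m * (u + n * v) < m * (n * n)" using assms 1 by (intro pair)
    show "X + m * (Y + m * (u + n * v)) < m * (m * (n * n))" using assms 2 by (intro pair)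
  qed
  ultimately show "r * round_length \<le> z" "Suc z \<le> Suc r * round_length"
    by (simp_all add: round_length_def mult.assoc)
qed

definition sg :: "nat \<Rightarrow> rat" where "sg i = (if i < k then 1 else - 1)"

definition terminal :: "nat \<Rightarrow> nat" where "terminal i = (if i < k then xs ! i else ys ! (i - k))"

text \<open>Sources occupy the low \<open>k\<close> bits and targets the high ones, so the sign of
  the imbalance is found by comparing two numbers of ones.\<close>

lemma sum_sg:
  assumes "A \<subseteq> {..<k + k}"
  shows "sum sg A = of_nat (popcount (set_encode A mod 2 ^ k)) - of_nat (popcount (set_encode A div 2 ^ k))"
proof -
  have fin: "finite A" using assms finite_subset by blast
  have "sum sg A = (\<Sum>i\<in>A \<inter> {..<k}. sg i) + (\<Sum>i\<in>A - {..<k}. sg i)"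
    using fin by (simp add: sum.Int_Diff)
  also have "\<dots> = of_nat (card (A \<inter> {..<k})) - of_nat (card (A - {..<k}))"
    by (simp add: sg_def)
  also have "A \<inter> {..<k} = set_decode (set_encode A mod 2 ^ k)"
    using fin by (auto simp: set_decode_mod_power)
  also have "A - {..<k} = (+) k ` set_decode (set_encode A div 2 ^ k)"
  proof (rule set_eqI)
    fix x
    have "x \<in> A - {..<k} \<longleftrightarrow> (\<exists>i. x = k + i \<and> k + i \<in> A)"
      by (auto intro: exI[of _ "x - k"])
    then show "x \<in> A - {..<k} \<longleftrightarrow> x \<in> (+) k ` set_decode (set_encode A div 2 ^ k)"
      using fin by (auto simp: set_decode_div_power)
  qed
  finally show ?thesis by (simp add: popcount_def card_image)
qed

text \<open>Identifies the divergence supplied by \<open>bij_occs_flow\<close> with the imbalance of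
  the terminals that start at \<open>v\<close>.\<close>

lemma count_terminals:
  assumes "v < n"
  shows "sum sg {i \<in> {..<k + k}. terminal i = v} = of_nat (count (mset xs) v) - of_nat (count (mset ys) v)"
proof -
  have "sum sg {i \<in> {..<k + k}. terminal i = v} = (\<Sum>i<k + k. if terminal i = v then sg i else 0)"
    by (simp add: sum.If_cases Int_def)
  also have "\<dots> = (\<Sum>i<k. if xs ! i = v then 1 else 0) + (\<Sum>i<k. if ys ! i = v then - 1 else 0)"
    unfolding sum_lessThan_add
    by (intro arg_cong2[where f = "(+)"] sum.cong) (auto simp: terminal_def sg_def)
  also have "\<dots> = of_nat (card {i. i < k \<and> xs ! i = v}) - of_nat (card {i. i < k \<and> ys ! i = v})"
    by (simp add: sum.If_cases Int_def)
  also have "\<dots> = of_nat (count (mset xs) v) - of_nat (count (mset ys) v)"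
    using len by (simp add: count_mset count_list_eq_length_filter length_filter_conv_card eq_commute)
  finally show ?thesis .
qed

text \<open>Each instance of a rule is realised by one counter value inside round \<open>r\<close>.
  Entries read there are at most those at the start of the round, and entries at its end are at most
  those just after that step, so monotonicity carries the inequality across the round.\<close>

lemma relaxation_iter:
  assumes "initial F"
  shows "relaxation n E w {..<k + k} sg (\<lambda>r A v. iter (r * round_length) F (set_encode A * n + v))"
proof
  let ?g = "\<lambda>r A v. iter (r * round_length) F (set_encode A * n + v)"
  have code: "set_encode A < m" "finite A" if "A \<subseteq> {..<k + k}" for A
    using that finite_subset[OF that] by (simp_all add: set_decode_less_m)
  have after: "iter (Suc r * round_length) F j \<le> step z (iter z F) j"
    if "X < m" "Y < m" "u < n" "v < n" "z = X + m * (Y + m * (u + n * (v + n * r)))" for X Y u v z r j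
    using iter_antimono[OF step_in_round(2)[OF that], of F j] by (simp only: iter.simps)
  have before: "iter z F j \<le> iter (r * round_length) F j"
    if "X < m" "Y < m" "u < n" "v < n" "z = X + m * (Y + m * (u + n * (v + n * r)))" for X Y u v z r j
    by (rule iter_antimono[OF step_in_round(1)[OF that]])
  show "0 < n" by (rule n_pos)
  show "E \<subseteq> {..<n} \<times> {..<n}" by (rule E)
  show "\<And>e. e \<in> E \<Longrightarrow> 0 \<le> w e" by (rule w_nonneg)
  show "finite {..<k + k}" by simp
  show "?g 0 {} v \<le> 0" if "v < n" for v
  proof -
    have "F (0 * n + v) = 0" using assms m_pos that unfolding initial_def by presburger
    then show ?thesis by simp
  qed
  show "?g (Suc r) A v \<le> ?g r A v" for r A v by (intro iter_antimono) simp
  show "?g (Suc r) (A \<union> B) v \<le> ?g r A v + ?g r B v"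
    if "A \<subseteq> {..<k + k}" "B \<subseteq> {..<k + k}" "A \<inter> B = {}" "v < n" for A B v r
  proof -
    define z where "z = set_encode A + m * (set_encode B + m * (v + n * (v + n * r)))"
    note z = code(1)[OF that(1)] code(1)[OF that(2)] that(4) that(4) z_def
    have p: "set_decode (set_encode A) \<inter> set_decode (set_encode B) = {}"
      using code(2)[OF that(1)] code(2)[OF that(2)] that(3) by simp
    note after[OF z] also note step_target(1)[OF z p]
    also note add_mono[OF before[OF z] before[OF z]]
    finally show ?thesis
      using code(2)[OF that(1)] code(2)[OF that(2)] that(3) by (simp add: set_encode_Un_disjoint)
  qed
  show "?g (Suc r) A y \<le> ?g r A x + w (x, y)"
    if "A \<subseteq> {..<k + k}" "(x, y) \<in> E" "0 < sum sg A" for A x y r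
  proof -
    have xy: "x < n" "y < n" using that(2) E by auto
    \<comment> \<open>The second code is set to \<open>0\<close>, the empty set, since only the move
      of this step is of interest.\<close>
    define z where "z = set_encode A + m * (0 + m * (x + n * (y + n * r)))"
    note z = code(1)[OF that(1)] m_pos xy z_def
    have p: "popcount (set_encode A div 2 ^ k) < popcount (set_encode A mod 2 ^ k)"
      using that(3) by (simp add: sum_sg[OF that(1)])
    note after[OF z] also note step_target(2)[OF z that(2) p]
    also note add_right_mono[OF before[OF z]]
    finally show ?thesis .
  qed
  show "?g (Suc r) A x \<le> ?g r A y + w (x, y)"
    if "A \<subseteq> {..<k + k}" "(x, y) \<in> E" "sum sg A < 0" for A x y r
  proof -
    have xy: "x < n" "y < n" using that(2) E by auto
    define z where "z = set_encode A + m * (0 + m * (x + n * (y + n * r)))"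
    note z = code(1)[OF that(1)] m_pos xy z_def
    have p: "popcount (set_encode A mod 2 ^ k) < popcount (set_encode A div 2 ^ k)"
      using that(3) by (simp add: sum_sg[OF that(1)])
    note after[OF z] also note step_target(3)[OF z that(2) p]
    also note add_right_mono[OF before[OF z]]
    finally show ?thesis .
  qed
  show "?g (Suc r) A y \<le> ?g r A x"
    if "A \<subseteq> {..<k + k}" "x < n" "y < n" "sum sg A = 0" for A x y r
  proof -
    define z where "z = set_encode A + m * (0 + m * (x + n * (y + n * r)))"
    note z = code(1)[OF that(1)] m_pos that(2,3) z_def
    have p: "popcount (set_encode A mod 2 ^ k) = popcount (set_encode A div 2 ^ k)"
      using that(4) by (simp add: sum_sg[OF that(1)])
    note after[OF z] also note step_target(4)[OF z p]
    also note before[OF z]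
    finally show ?thesis .
  qed
qed

lemma set_encode_lessThan: "set_encode {..<j} = 2 ^ j - 1"
  by (induction j) (simp_all add: lessThan_Suc)

lemma srcs_full: "srcs (m - 1) = mset xs" and tgts_full: "tgts (m - 1) = mset ys"
proof -
  have full: "set_decode (m - 1) = {..<k + k}"
    using set_encode_inverse[of "{..<k + k}"] by (simp add: set_encode_lessThan m_power)
  have codes: "{i. i < k \<and> i \<in> set_decode (m - 1)} = {0..<k}"
    "{i. i < k \<and> k + i \<in> set_decode (m - 1)} = {0..<k}" unfolding full by auto
  have zs: "image_mset ((!) zs) (mset_set {0..<length zs}) = mset zs" for zs :: "nat list"
    using mset_map[of "(!) zs" "[0..<length zs]"] by (simp only: map_nth mset_upt)
  show "srcs (m - 1) = mset xs" "tgts (m - 1) = mset ys"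
    unfolding srcs_def tgts_def codes using zs[of xs] zs[of ys] len by simp_all
qed

text \<open>The code \<open>m - 1\<close> is the set of all terminals. It is balanced, so its entry
  at vertex \<open>0\<close> is as good as at any other vertex.\<close>

lemma iter_correct:
  assumes "initial F"
  shows "iter ((2 * k + 4) * n * round_length) F ((m - 1) * n) \<le> l \<longleftrightarrow>
    (\<exists>K f. K \<subseteq> E \<and> sum w K \<le> l \<and> bij_betw f (occs (mset xs)) (occs (mset ys)) \<and>
      (\<forall>s\<in>occs (mset xs). (fst s, fst (f s)) \<in> K\<^sup>*))" (is "?q \<le> l \<longleftrightarrow> ?yes")
proof
  assume "?q \<le> l"
  with soundD[OF sound_iter[OF assms], of "m - 1" 0 "(2 * k + 4) * n * round_length"] n_pos obtain K where
    K: "K \<subseteq> E" "sum w K \<le> ?q" "serves (m - 1) 0 K" by (auto simp del: iter.simps)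
  have "rel_mset (\<lambda>x y. (x, y) \<in> K\<^sup>*) (mset xs) (mset ys)"
    using serves_surplus[OF K(3)] len unfolding srcs_full tgts_full by simp
  from rel_mset_occs_bij[OF this] obtain f where "bij_betw f (occs (mset xs)) (occs (mset ys))"
    "\<forall>s\<in>occs (mset xs). (fst s, fst (f s)) \<in> K\<^sup>*" by blast
  moreover have "sum w K \<le> l" using K(2) \<open>?q \<le> l\<close> by simp
  ultimately show ?yes using K(1) by blast
next
  assume ?yes
  then obtain K f where K: "K \<subseteq> E" "sum w K \<le> l" "bij_betw f (occs (mset xs)) (occs (mset ys))"
    "\<forall>s\<in>occs (mset xs). (fst s, fst (f s)) \<in> K\<^sup>*" by blast
  from bij_occs_flow[OF order_trans[OF K(1) E] K(3,4)] obtain \<phi> where \<phi>: "\<And>e. 0 \<le> \<phi> e" "supp \<phi> \<subseteq> K"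
    "\<And>v. divergence n \<phi> v = of_nat (count (mset xs) v) - of_nat (count (mset ys) v)" by blast
  interpret relaxation n E w "{..<k + k}" sg "\<lambda>r A v. iter (r * round_length) F (set_encode A * n + v)"
    by (rule relaxation_iter[OF assms])
  have start: "terminal i < n \<and> iter (0 * round_length) F (set_encode {i} * n + terminal i) \<le> 0"
    if "i \<in> {..<k + k}" for i
  proof -
    have t: "terminal i < n"
    proof (cases "i < k")
      case True
      then have "xs ! i \<in> set xs" using len by simp
      then show ?thesis using True xs_n by (auto simp: terminal_def)
    next
      case False
      then have "ys ! (i - k) \<in> set ys" using that len by simp
      then show ?thesis using False ys_n by (auto simp: terminal_def)
    qed
    have "2 ^ i < m" using that by (simp add: m_power)
    moreover have "\<exists>j<k. (2::nat) ^ i = 2 ^ j \<and> terminal i = xs ! j \<or>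
        (2::nat) ^ i = 2 ^ k * 2 ^ j \<and> terminal i = ys ! j"
    proof (cases "i < k")
      case False
      then show ?thesis using that
        by (intro exI[of _ "i - k"]) (auto simp: terminal_def power_add[symmetric])
    qed (auto simp: terminal_def)
    ultimately have "F (2 ^ i * n + terminal i) = 0" using assms t unfolding initial_def by simp
    then show ?thesis using t by (simp add: set_encode_def)
  qed
  \<comment> \<open>The required \<open>2 * k + 4 * n\<close> rounds are raised to a multiple of
    \<open>n\<close>, which keeps the total time of the form \<open>n ^ 3\<close> times a function
    of \<open>k\<close>.\<close>
  have R: "card {..<k + k} + 4 * n \<le> (2 * k + 4) * n"
    using n_pos by (cases n) (auto simp: algebra_simps)
  have "?q \<le> sum w (supp \<phi>)"
    using below_flow_cost[of terminal \<phi> "(2 * k + 4) * n", OF _ _ \<phi>(1) order_trans[OF \<phi>(2) K(1)] _ R]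
      start \<phi>(3) count_terminals
    by (simp add: set_encode_lessThan m_power)
  also have "\<dots> \<le> sum w K"
    using \<phi>(2) K(1) w_nonneg by (intro sum_mono2 finite_subset[OF K(1) finite_E]) auto
  finally show "?q \<le> l" using K(2) by simp
qed

end

section \<open>The program\<close>

definition runs :: "nat \<Rightarrow> com \<Rightarrow> state \<Rightarrow> nat \<Rightarrow> (state \<Rightarrow> bool) \<Rightarrow> bool" where
  "runs B c s t Q \<longleftrightarrow> (\<exists>t' s'. exec B c s t' s' \<and> t' \<le> t \<and> Q s')"

lemma runs_Skip: "Q s \<Longrightarrow> 1 \<le> t \<Longrightarrow> runs B Skip s t Q"
  unfolding runs_def using exec.Skip by blast

lemma runs_Put:
  "afits B a s \<Longrightarrow> afits B b s \<Longrightarrow> Q (put x (aval a s) (aval b s) s) \<Longrightarrow> acost a + acost b + 1 \<le> t \<Longrightarrow>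
    runs B (Put x a b) s t Q"
  unfolding runs_def using exec.Put by blast

lemma runs_WPut:
  "afits B a s \<Longrightarrow> wfits B e s \<Longrightarrow> Q (wput x (aval a s) (wval e s) s) \<Longrightarrow> acost a + wcost e + 1 \<le> t \<Longrightarrow>
    runs B (WPut x a e) s t Q"
  unfolding runs_def using exec.WPut by blast

lemma runs_Seq:
  assumes "runs B c1 s ta R" "\<And>s'. R s' \<Longrightarrow> runs B c2 s' tb Q" "ta + tb \<le> t"
  shows "runs B (Seq c1 c2) s t Q"
proof -
  from assms(1) obtain t1' s1 where 1: "exec B c1 s t1' s1" "t1' \<le> ta" "R s1" by (auto simp: runs_def)
  from assms(2)[OF 1(3)] obtain t2' s2 where 2: "exec B c2 s1 t2' s2" "t2' \<le> tb" "Q s2"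
    by (auto simp: runs_def)
  from exec.Seq[OF 1(1) 2(1)] 1 2 assms(3) show ?thesis unfolding runs_def by fastforce
qed

lemma runs_Cond:
  assumes "bfits B b s" "bval b s \<Longrightarrow> runs B c1 s t' Q" "\<not> bval b s \<Longrightarrow> runs B c2 s t' Q"
    and "bcost b + t' + 1 \<le> t"
  shows "runs B (Cond b c1 c2) s t Q"
proof (cases "bval b s")
  case True
  with assms(2) obtain t1 s1 where "exec B c1 s t1 s1" "t1 \<le> t'" "Q s1" by (auto simp: runs_def)
  with exec.CondTrue[OF assms(1) True] assms(4) show ?thesis unfolding runs_def by fastforce
next
  case False
  with assms(3) obtain t1 s1 where "exec B c2 s t1 s1" "t1 \<le> t'" "Q s1" by (auto simp: runs_def)
  with exec.CondFalse[OF assms(1) False] assms(4) show ?thesis unfolding runs_def by fastforce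
qed

lemma runs_mono: "runs B c s t Q \<Longrightarrow> t \<le> t' \<Longrightarrow> (\<And>s'. Q s' \<Longrightarrow> Q' s') \<Longrightarrow> runs B c s t' Q'"
  unfolding runs_def by (meson le_trans)

text \<open>The invariant is indexed by the iteration, which fixes the number of iterations and
  hence the cost in advance.\<close>

lemma runs_While:
  assumes step: "\<And>i s. i < j \<Longrightarrow> I i s \<Longrightarrow> bfits B b s \<and> bval b s \<and> runs B c s t (I (Suc i))"
    and stop: "\<And>s. I j s \<Longrightarrow> bfits B b s \<and> \<not> bval b s"
    and start: "I i s" "i \<le> j"
  shows "runs B (While b c) s ((j - i) * (t + bcost b + 1) + bcost b + 1) (I j)"
  using start
proof (induction "j - i" arbitrary: i s)
  case 0
  then have "I j s" by simp
  with stop[OF this] exec.WhileFalse show ?case unfolding runs_def by fastforce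
next
  case (Suc d)
  then have i: "i < j" "d = j - Suc i" by auto
  with step[OF i(1) Suc.prems(1)] obtain t1 s1 where
    1: "bfits B b s" "bval b s" "exec B c s t1 s1" "t1 \<le> t" "I (Suc i) s1" by (auto simp: runs_def)
  from Suc.hyps(1)[OF i(2) 1(5)] i obtain t2 s2 where
    2: "exec B (While b c) s1 t2 s2" "t2 \<le> (j - Suc i) * (t + bcost b + 1) + bcost b + 1" "I j s2"
    by (auto simp: runs_def)
  have "j - i = Suc (j - Suc i)" using i by simp
  with exec.WhileTrue[OF 1(1-3) 2(1)] 1(4) 2 show ?case unfolding runs_def
    by (intro exI[of _ "bcost b + t1 + t2 + 1"] exI[of _ s2]) simp
qed

abbreviation V :: "vname \<Rightarrow> aexp" where "V x \<equiv> Get x (N 0)"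

lemma put_simps [simp]:
  "words (put x i a s) = (words s)(x := (words s x)(i := a))"
  "weights (put x i a s) = weights s"
  "words (wput x i q s) = words s"
  "weights (wput x i q s) = (weights s)(x := (weights s x)(i := q))"
  by (simp_all add: put_def wput_def)

text \<open>All loops count in \<open>z\<close>, so a body finds its index there; this is possible
  because no loop is nested in another.\<close>

definition For :: "aexp \<Rightarrow> com \<Rightarrow> com" where
  "For a c = Seq (Put ''z'' (N 0) (N 0))
     (While (Less (V ''z'') a) (Seq c (Put ''z'' (N 0) (Plus (V ''z'') (N 1)))))"

text \<open>Origin of the constants: \<open>3\<close> for the initialisation, \<open>6\<close> for
  each increment, and \<open>acost a + 4\<close> for each evaluation of the guard including the
  last.\<close>

lemma runs_For:
  assumes start: "I 0 (put ''z'' 0 0 s)"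
    and bound: "\<And>i s. I i s \<Longrightarrow> words s ''z'' 0 = i \<and> afits B a s \<and> aval a s = b" "b \<le> B" "1 \<le> B"
    and body: "\<And>i s. i < b \<Longrightarrow> I i s \<Longrightarrow>
      runs B c s t (\<lambda>s'. words s' ''z'' 0 = i \<and> I (Suc i) (put ''z'' 0 (Suc i) s'))"
    and post: "\<And>s. I b s \<Longrightarrow> Q s"
    and time: "b * (t + acost a + 10) + acost a + 7 \<le> t'"
  shows "runs B (For a c) s t' Q"
  unfolding For_def
proof (rule runs_Seq)
  show "runs B (Put ''z'' (N 0) (N 0)) s 3 (I 0)"
    using start by (intro runs_Put) simp_all
next
  fix s' assume I0: "I 0 s'"
  let ?c = "Seq c (Put ''z'' (N 0) (Plus (V ''z'') (N 1)))"
  let ?b = "Less (V ''z'') a"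
  have "runs B ?c s (t + 6) (I (Suc i))" if "i < b" "I i s" for i s
  proof (rule runs_Seq[OF body[OF that]])
    fix s' assume "words s' ''z'' 0 = i \<and> I (Suc i) (put ''z'' 0 (Suc i) s')"
    then show "runs B (Put ''z'' (N 0) (Plus (V ''z'') (N 1))) s' 6 (I (Suc i))"
      using that bound(2,3) by (intro runs_Put) simp_all
  qed simp
  moreover have "bfits B ?b s \<and> (bval ?b s \<longleftrightarrow> i < b)" if "I i s" "i \<le> b" for i s
    using bound(1)[OF that(1)] bound(2,3) that(2) by simp
  ultimately have "runs B (While ?b ?c) s' ((b - 0) * (t + 6 + bcost ?b + 1) + bcost ?b + 1) (I b)"
    using I0 by (intro runs_While) auto
  then show "runs B (While ?b ?c) s' (b * (t + acost a + 10) + acost a + 4) Q"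
    by (rule runs_mono) (auto simp: post add_ac)
qed (use time in simp)

definition relaxc :: "aexp \<Rightarrow> wexp \<Rightarrow> com" where
  "relaxc a e = Cond (WLess e (WGet ''f'' a)) (WPut ''f'' a e) Skip"

text \<open>Allows a postcondition to give the final state exactly when only the table
  \<open>f\<close> has changed.\<close>

definition setf :: "(nat \<Rightarrow> rat) \<Rightarrow> state \<Rightarrow> state" where
  "setf F s = s\<lparr>weights := (weights s)(''f'' := F)\<rparr>"

lemma setf_simps [simp]:
  "words (setf F s) = words s"
  "weights (setf F s) = (weights s)(''f'' := F)"
  "setf F (setf G s) = setf F s"
  "setf (weights s ''f'') s = s"
  by (simp_all add: setf_def)

lemma runs_relaxc:
  assumes "afits B a s" "wfits B e s"
    and "Q (setf (relax (aval a s) (wval e s) (weights s ''f'')) s)" "2 * acost a + 2 * wcost e + 4 \<le> t"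
  shows "runs B (relaxc a e) s t Q"
  unfolding relaxc_def
proof (rule runs_Cond)
  have wput_setf: "wput ''f'' i q s = setf ((weights s ''f'')(i := q)) s" for i q by (simp add: wput_def setf_def)
  show "runs B (WPut ''f'' a e) s (acost a + wcost e + 1) Q" if "bval (WLess e (WGet ''f'' a)) s"
    using assms that by (intro runs_WPut) (simp_all add: relax_def wput_setf)
  show "runs B Skip s (acost a + wcost e + 1) Q" if "\<not> bval (WLess e (WGet ''f'' a)) s"
    using assms that by (intro runs_Skip) (simp_all add: relax_def)
qed (use assms in simp_all)

section \<open>The commands of the program\<close>

definition cell :: "aexp \<Rightarrow> aexp \<Rightarrow> aexp" where
  "cell a b = Plus (Times a (V ''n'')) b"

definition eX :: aexp where "eX = Mod (V ''z'') (V ''M'')"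
definition eY :: aexp where "eY = Mod (Div (V ''z'') (V ''M'')) (V ''M'')"
definition eu :: aexp where "eu = Mod (Div (Div (V ''z'') (V ''M'')) (V ''M'')) (V ''n'')"
definition ev :: aexp where
  "ev = Mod (Div (Div (Div (V ''z'') (V ''M'')) (V ''M'')) (V ''n'')) (V ''n'')"

definition merge_com :: com where
  "merge_com = Cond (Less (Get ''p'' (Plus eX eY)) (Plus (Get ''p'' eX) (Get ''p'' eY))) Skip
     (relaxc (cell (Plus eX eY) eu) (WPlus (WGet ''f'' (cell eX eu)) (WGet ''f'' (cell eY eu))))"

definition move_com :: com where
  "move_com =
     Cond (Less (Get ''p'' (Div eX (V ''K''))) (Get ''p'' (Mod eX (V ''K''))))
       (Cond (Less (N 0) (Get ''A'' (cell eu ev)))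
         (relaxc (cell eX ev) (WPlus (WGet ''f'' (cell eX eu)) (WGet ''w'' (cell eu ev)))) Skip)
     (Cond (Less (Get ''p'' (Mod eX (V ''K''))) (Get ''p'' (Div eX (V ''K''))))
       (Cond (Less (N 0) (Get ''A'' (cell eu ev)))
         (relaxc (cell eX eu) (WPlus (WGet ''f'' (cell eX ev)) (WGet ''w'' (cell eu ev)))) Skip)
       (relaxc (cell eX ev) (WGet ''f'' (cell eX eu))))"

definition powers_com :: com where
  "powers_com = Seq (Put ''e'' (N 0) (N 1))
     (Seq (For (V ''k'') (Put ''e'' (N 0) (Plus (V ''e'') (V ''e''))))
     (Seq (Put ''K'' (N 0) (V ''e'')) (Put ''M'' (N 0) (Times (V ''e'') (V ''e'')))))"

text \<open>At \<open>z = 0\<close> the recurrence reads the cell that it writes and relies on its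
  being zero beforehand. The table has \<open>2 * m\<close> entries because it is also consulted at
  sums of two codes.\<close>

definition popcount_com :: com where
  "popcount_com = For (Plus (V ''M'') (V ''M''))
     (Put ''p'' (V ''z'') (Plus (Get ''p'' (Div (V ''z'') (N 2))) (Mod (V ''z'') (N 2))))"

text \<open>The cells below \<open>n\<close> are those of code \<open>0\<close>, the empty
  set.\<close>

definition fill_com :: com where
  "fill_com = For (Times (V ''M'') (V ''n''))
     (Cond (Less (V ''z'') (V ''n'')) (WPut ''f'' (V ''z'') (WConst 0))
       (WPut ''f'' (V ''z'') (WPlus (WGet ''l'' (N 0)) (WConst 1))))"

definition terminals_com :: com where
  "terminals_com = Seq (Put ''e'' (N 0) (N 1))
     (For (V ''k'')
       (Seq (WPut ''f'' (cell (V ''e'') (Get ''S'' (V ''z''))) (WConst 0))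
       (Seq (WPut ''f'' (cell (Times (V ''K'') (V ''e'')) (Get ''T'' (V ''z''))) (WConst 0))
         (Put ''e'' (N 0) (Plus (V ''e'') (V ''e''))))))"

definition rounds_com :: com where
  "rounds_com = For (Times (Times (Plus (Times (N 2) (V ''k'')) (N 4)) (V ''n''))
     (Times (Times (Times (V ''M'') (V ''M'')) (V ''n'')) (V ''n''))) (Seq merge_com move_com)"

definition answer_com :: com where
  "answer_com = Cond (WLess (WGet ''l'' (N 0)) (WGet ''f'' (Times (Minus (V ''M'') (N 1)) (V ''n''))))
     (Put ''out'' (N 0) (N 0)) (Put ''out'' (N 0) (N 1))"

definition program :: com where
  "program = Cond (WLess (WGet ''l'' (N 0)) (WConst 0)) (Put ''out'' (N 0) (N 0))
     (Seq powers_com (Seq popcount_com (Seq fill_com (Seq terminals_com (Seq rounds_com answer_com)))))"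

lemma popcount_le: "popcount X \<le> X"
proof (induction X rule: less_induct)
  case (less X)
  show ?case
  proof (cases "X = 0")
    case False
    then have "popcount (X div 2) \<le> X div 2" by (intro less) simp
    then show ?thesis using popcount_rec[of X] by linarith
  qed simp
qed

section \<open>Correctness, running time and word size of the commands\<close>

context routing
begin

definition inputs :: "state \<Rightarrow> bool" where
  "inputs s \<longleftrightarrow> words s ''n'' 0 = n \<and> words s ''k'' 0 = k \<and>
     (\<forall>i<k. words s ''S'' i = xs ! i) \<and> (\<forall>i<k. words s ''T'' i = ys ! i) \<and>
     (\<forall>u<n. \<forall>v<n. words s ''A'' (u * n + v) = (if (u, v) \<in> E then 1 else 0)) \<and>
     weights s ''l'' 0 = l \<and> (\<forall>u<n. \<forall>v<n. (u, v) \<in> E \<longrightarrow> weights s ''w'' (u * n + v) = w (u, v))"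

definition tables :: "state \<Rightarrow> bool" where
  "tables s \<longleftrightarrow> inputs s \<and> words s ''K'' 0 = 2 ^ k \<and> words s ''M'' 0 = m \<and>
     (\<forall>X<m + m. words s ''p'' X = popcount X)"

lemma inputs_cong:
  assumes "\<forall>x\<in>{''n'', ''k'', ''S'', ''T'', ''A''}. words s x = words s' x"
    and "\<forall>x\<in>{''l'', ''w''}. weights s x = weights s' x"
  shows "inputs s = inputs s'"
  using assms unfolding inputs_def by simp

lemma tables_cong:
  assumes "\<forall>x\<in>{''n'', ''k'', ''S'', ''T'', ''A'', ''K'', ''M'', ''p''}. words s x = words s' x"
    and "\<forall>x\<in>{''l'', ''w''}. weights s x = weights s' x"
  shows "tables s = tables s'"
  using assms inputs_cong[of s s'] unfolding tables_def by simp

lemma inputs_put [simp]: "x \<notin> {''n'', ''k'', ''S'', ''T'', ''A''} \<Longrightarrow> inputs (put x i a s) = inputs s"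
  by (rule inputs_cong) auto

lemma tables_put [simp]:
  "x \<notin> {''n'', ''k'', ''S'', ''T'', ''A'', ''K'', ''M'', ''p''} \<Longrightarrow> tables (put x i a s) = tables s"
  by (rule tables_cong) auto

lemma tables_wput [simp]: "x \<notin> {''l'', ''w''} \<Longrightarrow> tables (wput x i q s) = tables s"
  by (rule tables_cong) auto

lemma tables_setf [simp]: "tables (setf F s) = tables s"
  by (rule tables_cong) auto

lemma inputsD:
  assumes "inputs s"
  shows "words s ''n'' 0 = n" "words s ''k'' 0 = k" "weights s ''l'' 0 = l"
    and "i < k \<Longrightarrow> words s ''S'' i = xs ! i" "i < k \<Longrightarrow> words s ''T'' i = ys ! i"
    and "u < n \<Longrightarrow> v < n \<Longrightarrow> words s ''A'' (u * n + v) = (if (u, v) \<in> E then 1 else 0)"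
    and "u < n \<Longrightarrow> v < n \<Longrightarrow> (u, v) \<in> E \<Longrightarrow> weights s ''w'' (u * n + v) = w (u, v)"
  using assms by (simp_all add: inputs_def)

lemma tablesD:
  assumes "tables s"
  shows "inputs s" "words s ''K'' 0 = 2 ^ k" "words s ''M'' 0 = m"
    and "X < m + m \<Longrightarrow> words s ''p'' X = popcount X"
  using assms by (simp_all add: tables_def)

definition steps :: nat where "steps = (2 * k + 4) * n * round_length"

text \<open>These inequalities control the word size: table addresses, also those for sums of two
  codes, and the partial products of the loop bound stay within \<open>steps\<close>.\<close>

lemma steps_ge: "4 * (m * n) \<le> steps" "2 * k + 4 \<le> steps" "(2 * k + 4) * n \<le> steps"
  "m * m \<le> steps" "m * m * n \<le> steps" "round_length \<le> steps" "n * n \<le> steps"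
proof -
  have 1: "1 \<le> n" "1 \<le> m" using n_pos m_pos by linarith+
  have le_mult: "a \<le> a * b" "a \<le> b * a" if "1 \<le> b" for a b :: nat using that by simp_all
  have 2: "round_length = (m * m) * (n * n)" "round_length = (m * n) * (m * n)"
    "round_length = (m * m * n) * n" by (simp_all add: round_length_def ac_simps)
  have "1 * 1 \<le> n * n" "1 * 1 \<le> m * n" "1 * 1 \<le> m * m" using 1 by (intro mult_le_mono; simp)+
  then have r: "m * n \<le> round_length" "m * m \<le> round_length" "m * m * n \<le> round_length"
      "n * n \<le> round_length"
    using 2 le_mult 1 by simp_all
  have "4 * 1 \<le> (2 * k + 4) * n" using 1 by (intro mult_le_mono) simp_all
  then have 4: "4 \<le> (2 * k + 4) * n" by simp
  have "4 * (m * n) \<le> (2 * k + 4) * n * round_length" using 4 r by (intro mult_le_mono)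
  then show "4 * (m * n) \<le> steps" by (simp add: steps_def)
  have "1 * 1 \<le> round_length" using \<open>1 * 1 \<le> m * n\<close> r(1) by (rule order_trans)
  then have "1 \<le> round_length" by simp
  then show 3: "(2 * k + 4) * n \<le> steps" unfolding steps_def by (rule le_mult)
  have "2 * k + 4 \<le> (2 * k + 4) * n" using 1(1) by (rule le_mult)
  then show "2 * k + 4 \<le> steps" using 3 by (rule order_trans)
  show 6: "round_length \<le> steps" unfolding steps_def using 4 by (intro le_mult) linarith
  show "m * m \<le> steps" "m * m * n \<le> steps" "n * n \<le> steps" using r 6 by simp_all
qed

lemma scalar_bounds:
  assumes "steps \<le> B"
  shows "n \<le> B" "m \<le> B" "m + m \<le> B" "k \<le> B" "2 ^ k \<le> B" "4 \<le> B" "X < m + m \<Longrightarrow> u < n \<Longrightarrow> X * n + u \<le> B"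
    "m * n \<le> B" "u < n \<Longrightarrow> v < n \<Longrightarrow> u * n + v \<le> B"
proof -
  have "m * 1 \<le> m * n" "1 * n \<le> m * n" using n_pos m_pos by (intro mult_le_mono; linarith)+
  then have mn: "m \<le> m * n" "n \<le> m * n" by simp_all
  then show 1: "n \<le> B" "m \<le> B" "m + m \<le> B" "k \<le> B" "4 \<le> B" "m * n \<le> B"
    using steps_ge(1,2) assms by linarith+
  have "2 ^ k * 1 \<le> m" unfolding m_def by (intro mult_le_mono) simp_all
  then show "2 ^ k \<le> B" using 1(2) by simp
  show "u * n + v \<le> B" if "u < n" "v < n"
  proof -
    have "u * n + v \<le> Suc u * n" using that by simp
    also have "\<dots> \<le> n * n" using that by (intro mult_le_mono1) simp
    finally show ?thesis using steps_ge(7) assms by simp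
  qed
  assume "X < m + m" "u < n"
  then have "X * n + u < Suc X * n" by simp
  also have "\<dots> \<le> (m + m) * n" using \<open>X < m + m\<close> by (intro mult_le_mono1) simp
  finally show "X * n + u \<le> B" using steps_ge(1) assms by (simp add: algebra_simps)
qed

lemma aval_cell: "inputs s \<Longrightarrow> aval (cell a b) s = aval a s * n + aval b s"
  by (simp add: cell_def inputsD)

lemma afits_cell:
  "inputs s \<Longrightarrow> n \<le> B \<Longrightarrow> afits B a s \<Longrightarrow> afits B b s \<Longrightarrow> aval a s * n + aval b s \<le> B \<Longrightarrow>
    afits B (cell a b) s"
  by (simp add: cell_def inputsD)

lemma acost_exprs: "acost eX = 5" "acost eY = 8" "acost eu = 11" "acost ev = 14"
  "acost (cell a b) = acost a + acost b + 4"
  by (simp_all add: eX_def eY_def eu_def ev_def cell_def)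

context
  fixes B :: nat and s :: state and z :: nat
  assumes steps_B: "steps \<le> B" and tables: "tables s" and z: "words s ''z'' 0 = z" "z \<le> B"
begin

abbreviation "X0 \<equiv> z mod m"
abbreviation "Y0 \<equiv> z div m mod m"
abbreviation "u0 \<equiv> z div m div m mod n"
abbreviation "v0 \<equiv> z div m div m div n mod n"
abbreviation "F0 \<equiv> weights s ''f''"

lemma exprs_aval: "aval eX s = X0" "aval eY s = Y0" "aval eu s = u0" "aval ev s = v0"
  using tables z by (simp_all add: eX_def eY_def eu_def ev_def tablesD inputsD)

lemma exprs_less: "X0 < m" "Y0 < m" "u0 < n" "v0 < n"
  using n_pos by simp_all

lemma exprs_afits: "afits B eX s" "afits B eY s" "afits B eu s" "afits B ev s"
proof -
  have "z div a \<le> B" "z div a div b \<le> B" "z div a div b div c \<le> B" for a b c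
    using z(2) by (meson div_le_dividend order_trans)+
  moreover have "X0 \<le> B" "Y0 \<le> B" "u0 \<le> B" "v0 \<le> B"
    using exprs_less scalar_bounds(1,2)[OF steps_B] by linarith+
  ultimately show "afits B eX s" "afits B eY s" "afits B eu s" "afits B ev s"
    using tables z scalar_bounds(1,2)[OF steps_B]
    by (simp_all add: eX_def eY_def eu_def ev_def tablesD inputsD)
qed

lemma cells_less: "X0 + Y0 < m + m" "X0 < m + m" "Y0 < m + m"
  "X0 mod 2 ^ k < m + m" "X0 div 2 ^ k < m + m"
proof -
  show "X0 + Y0 < m + m" "X0 < m + m" "Y0 < m + m" using exprs_less by linarith+
  show "X0 mod 2 ^ k < m + m" "X0 div 2 ^ k < m + m"
    using \<open>X0 < m + m\<close> mod_less_eq_dividend[of X0 "2 ^ k"] div_le_dividend[of X0 "2 ^ k"]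
    by linarith+
qed

definition F1 :: "nat \<Rightarrow> rat" where
  "F1 = (if popcount (X0 + Y0) < popcount X0 + popcount Y0 then F0
    else relax ((X0 + Y0) * n + u0) (F0 (X0 * n + u0) + F0 (Y0 * n + u0)) F0)"

lemma runs_merge: "runs B merge_com s 300 (\<lambda>s'. s' = setf F1 s)"
  unfolding merge_com_def
proof (rule runs_Cond)
  let ?b = "Less (Get ''p'' (Plus eX eY)) (Plus (Get ''p'' eX) (Get ''p'' eY))"
  note simps = exprs_aval exprs_afits tablesD(4)[OF tables cells_less(1)]
    tablesD(4)[OF tables cells_less(2)] tablesD(4)[OF tables cells_less(3)]
  have "X0 + Y0 \<le> B" using cells_less(1) scalar_bounds(3)[OF steps_B] by linarith
  moreover have "popcount X0 + popcount Y0 \<le> X0 + Y0" "popcount (X0 + Y0) \<le> X0 + Y0"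
    by (intro add_mono popcount_le)+
  ultimately have le: "X0 + Y0 \<le> B" "popcount X0 + popcount Y0 \<le> B" "popcount (X0 + Y0) \<le> B" by linarith+
  then show "bfits B ?b s" by (simp add: simps)
  have inp: "inputs s" using tables by (rule tablesD)
  have cells: "afits B (cell (Plus eX eY) eu) s" "afits B (cell eX eu) s" "afits B (cell eY eu) s"
    using scalar_bounds(7)[OF steps_B cells_less(1) exprs_less(3)]
      scalar_bounds(7)[OF steps_B cells_less(2) exprs_less(3)]
      scalar_bounds(7)[OF steps_B cells_less(3) exprs_less(3)] le
    by (intro afits_cell inp scalar_bounds(1)[OF steps_B]; simp add: simps)+
  show "runs B Skip s 200 (\<lambda>s'. s' = setf F1 s)" if "bval ?b s"
    using that by (intro runs_Skip) (simp_all add: simps F1_def)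
  show "runs B (relaxc (cell (Plus eX eY) eu) (WPlus (WGet ''f'' (cell eX eu)) (WGet ''f'' (cell eY eu)))) s 200
    (\<lambda>s'. s' = setf F1 s)" if "\<not> bval ?b s"
    using that cells
    by (intro runs_relaxc) (simp_all add: simps aval_cell[OF inp] acost_exprs F1_def)
qed (simp add: acost_exprs)

lemma runs_move: "runs B move_com s 300 (\<lambda>s'. s' = setf
     (if popcount (X0 div 2 ^ k) < popcount (X0 mod 2 ^ k)
      then (if (u0, v0) \<in> E then relax (X0 * n + v0) (F0 (X0 * n + u0) + w (u0, v0)) F0 else F0)
      else if popcount (X0 mod 2 ^ k) < popcount (X0 div 2 ^ k)
      then (if (u0, v0) \<in> E then relax (X0 * n + u0) (F0 (X0 * n + v0) + w (u0, v0)) F0 else F0)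
      else relax (X0 * n + v0) (F0 (X0 * n + u0)) F0) s)" (is "runs _ _ _ _ ?Q")
proof -
  let ?P = "popcount (X0 div 2 ^ k)" and ?P' = "popcount (X0 mod 2 ^ k)"
  have inp: "inputs s" using tables by (rule tablesD)
  note simps = exprs_aval exprs_afits tablesD(2)[OF tables] tablesD(4)[OF tables cells_less(4)]
    tablesD(4)[OF tables cells_less(5)] aval_cell[OF inp]
  have le: "?P \<le> B" "?P' \<le> B" "X0 div 2 ^ k \<le> B" "X0 mod 2 ^ k \<le> B"
    using cells_less(4,5) popcount_le[of "X0 div 2 ^ k"] popcount_le[of "X0 mod 2 ^ k"]
      scalar_bounds(3)[OF steps_B] by linarith+
  have cells: "afits B (cell eX eu) s" "afits B (cell eX ev) s" "afits B (cell eu ev) s"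
    using scalar_bounds(7)[OF steps_B cells_less(2) exprs_less(3)]
      scalar_bounds(7)[OF steps_B cells_less(2) exprs_less(4)]
      scalar_bounds(9)[OF steps_B exprs_less(3,4)]
    by (intro afits_cell inp scalar_bounds(1)[OF steps_B]; simp add: simps)+
  note inputsD(6)[OF inp exprs_less(3,4)] inputsD(7)[OF inp exprs_less(3,4)]
  note arc = this
  let ?b1 = "Less (Get ''p'' (Div eX (V ''K''))) (Get ''p'' (Mod eX (V ''K'')))"
  let ?b2 = "Less (Get ''p'' (Mod eX (V ''K''))) (Get ''p'' (Div eX (V ''K'')))"
  let ?a = "Less (N 0) (Get ''A'' (cell eu ev))"
  have fits: "bfits B ?b1 s" "bfits B ?b2 s"
    using le scalar_bounds(5)[OF steps_B] by (simp_all add: simps)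
  have afits: "bfits B ?a s" using cells scalar_bounds(6)[OF steps_B] by (simp add: simps arc)
  have val: "bval ?b1 s \<longleftrightarrow> ?P < ?P'" "bval ?b2 s \<longleftrightarrow> ?P' < ?P" "bval ?a s \<longleftrightarrow> (u0, v0) \<in> E"
    by (simp_all add: simps arc)
  have *: "runs B (Cond ?a (relaxc (cell eX e1) (WPlus (WGet ''f'' (cell eX e2)) (WGet ''w'' (cell eu ev)))) Skip)
      s 220 ?Q" if "e1 = ev \<and> e2 = eu \<and> ?P < ?P' \<or> e1 = eu \<and> e2 = ev \<and> ?P' < ?P" for e1 e2
  proof (rule runs_Cond[OF afits])
    show "runs B (relaxc (cell eX e1) (WPlus (WGet ''f'' (cell eX e2)) (WGet ''w'' (cell eu ev)))) s 180 ?Q"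
      if "bval ?a s"
      using that \<open>e1 = ev \<and> _ \<or> _\<close> cells unfolding val
      by (intro runs_relaxc) (auto simp: simps arc acost_exprs)
    show "runs B Skip s 180 ?Q" if "\<not> bval ?a s"
      using that \<open>e1 = ev \<and> _ \<or> _\<close> unfolding val by (intro runs_Skip) (auto simp: arc)
  qed (simp add: acost_exprs)
  show ?thesis unfolding move_com_def
  proof (rule runs_Cond[OF fits(1)])
    show "runs B (Cond ?a (relaxc (cell eX ev) (WPlus (WGet ''f'' (cell eX eu)) (WGet ''w'' (cell eu ev)))) Skip)
      s 260 ?Q" if "bval ?b1 s"
      using that unfolding val by (intro runs_mono[OF *]) auto
    show "runs B (Cond ?b2 (Cond ?a (relaxc (cell eX eu) (WPlus (WGet ''f'' (cell eX ev)) (WGet ''w'' (cell eu ev)))) Skip)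
      (relaxc (cell eX ev) (WGet ''f'' (cell eX eu)))) s 260 ?Q" if "\<not> bval ?b1 s"
    proof (rule runs_Cond[OF fits(2)])
      show "runs B (Cond ?a (relaxc (cell eX eu) (WPlus (WGet ''f'' (cell eX ev)) (WGet ''w'' (cell eu ev)))) Skip)
        s 220 ?Q" if "bval ?b2 s"
        using that unfolding val by (intro *) auto
      show "runs B (relaxc (cell eX ev) (WGet ''f'' (cell eX eu))) s 220 ?Q" if "\<not> bval ?b2 s"
        using that \<open>\<not> bval ?b1 s\<close> cells unfolding val
        by (intro runs_relaxc) (auto simp: simps acost_exprs)
    qed (simp add: acost_exprs)
  qed (simp add: acost_exprs)
qed

end

lemma runs_step:
  assumes "steps \<le> B" "tables s" "words s ''z'' 0 = z" "z \<le> B"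
  shows "runs B (Seq merge_com move_com) s 600 (\<lambda>s'. s' = setf (step z (weights s ''f'')) s)"
proof (rule runs_Seq[OF runs_merge[OF assms]])
  let ?G = "F1 s z"
  show "runs B move_com s' 300 (\<lambda>s''. s'' = setf (step z (weights s ''f'')) s)" if "s' = setf ?G s" for s'
  proof (rule runs_mono[OF runs_move[of B s' z]])
    show "tables s'" "words s' ''z'' 0 = z" using that assms by simp_all
  qed (use assms that in \<open>simp_all add: step_def Let_def F1_def[OF assms]\<close>)
qed simp

text \<open>As \<open>b'\<close> is positive, the additive overhead of a loop can be charged to it
  too, leaving a plain multiple. With \<open>b' = steps\<close> the costs of all loops can simply be
  added.\<close>

lemma runs_For_linear:
  assumes "I 0 (put ''z'' 0 0 s)"
    and "\<And>i s. I i s \<Longrightarrow> words s ''z'' 0 = i \<and> afits B a s \<and> aval a s = b" "b \<le> b'" "4 \<le> b'" "b' \<le> B"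
    and "\<And>i s. i < b \<Longrightarrow> I i s \<Longrightarrow>
      runs B c s t (\<lambda>s'. words s' ''z'' 0 = i \<and> I (Suc i) (put ''z'' 0 (Suc i) s'))"
    and "\<And>s. I b s \<Longrightarrow> Q s"
    and "t + 2 * acost a + 17 \<le> d"
  shows "runs B (For a c) s (d * b') Q"
proof (rule runs_For[of I s B a b c t])
  have "b * (t + acost a + 10) \<le> b' * (t + acost a + 10)" "1 * (acost a + 7) \<le> b' * (acost a + 7)"
    using assms(3,4) by (intro mult_le_mono1; simp)+
  from add_mono[OF this]
  have "b * (t + acost a + 10) + acost a + 7 \<le> b' * (t + acost a + 10) + b' * (acost a + 7)"
    by (simp only: mult_1 add.assoc)
  also have "\<dots> = b' * (t + 2 * acost a + 17)" by (simp add: algebra_simps)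
  also have "\<dots> \<le> b' * d" using assms(8) by (rule mult_le_mono2)
  finally show "b * (t + acost a + 10) + acost a + 7 \<le> d * b'" by (simp add: mult.commute)
qed (use assms in \<open>simp_all\<close>)

lemma runs_powers:
  assumes "steps \<le> B" "inputs s" "words s ''p'' 0 = 0"
  shows "runs B powers_com s (100 * steps)
    (\<lambda>s'. inputs s' \<and> words s' ''K'' 0 = 2 ^ k \<and> words s' ''M'' 0 = m \<and> words s' ''p'' 0 = 0)"
proof -
  note bounds = scalar_bounds[OF assms(1)] scalar_bounds[OF order_refl]
  let ?I = "\<lambda>i s. inputs s \<and> words s ''z'' 0 = i \<and> words s ''e'' 0 = 2 ^ i \<and> words s ''p'' 0 = 0"
  let ?R = "\<lambda>s. inputs s \<and> words s ''e'' 0 = 2 ^ k \<and> words s ''p'' 0 = 0"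
  let ?Q = "\<lambda>s. inputs s \<and> words s ''K'' 0 = 2 ^ k \<and> words s ''M'' 0 = m \<and> words s ''p'' 0 = 0"
  have loop: "runs B (For (V ''k'') (Put ''e'' (N 0) (Plus (V ''e'') (V ''e'')))) s (40 * steps) ?R"
    if "inputs s \<and> words s ''e'' 0 = 1 \<and> words s ''p'' 0 = 0" for s
  proof (rule runs_For_linear[where I = ?I and b = k and t = 7])
    fix i s assume i: "i < k" "?I i s"
    have "(2::nat) ^ i \<le> 2 ^ k" "2 ^ Suc i \<le> (2::nat) ^ k"
      using i(1) by (intro power_increasing; simp)+
    then show "runs B (Put ''e'' (N 0) (Plus (V ''e'') (V ''e''))) s 7
      (\<lambda>s'. words s' ''z'' 0 = i \<and> ?I (Suc i) (put ''z'' 0 (Suc i) s'))"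
      using i bounds(5) by (intro runs_Put) simp_all
  qed (use that assms bounds in \<open>simp_all add: inputsD\<close>)
  have start: "runs B (Put ''e'' (N 0) (N 1)) s 3 (\<lambda>s. inputs s \<and> words s ''e'' 0 = 1 \<and> words s ''p'' 0 = 0)"
    using assms bounds by (intro runs_Put) simp_all
  have stop: "runs B (Seq (Put ''K'' (N 0) (V ''e'')) (Put ''M'' (N 0) (Times (V ''e'') (V ''e'')))) s 20 ?Q"
    if "?R s" for s
  proof (rule runs_Seq[where R = "\<lambda>s. ?R s \<and> words s ''K'' 0 = 2 ^ k"])
    show "runs B (Put ''K'' (N 0) (V ''e'')) s 5 (\<lambda>s. ?R s \<and> words s ''K'' 0 = 2 ^ k)"
      using that bounds by (intro runs_Put) simp_all
    show "runs B (Put ''M'' (N 0) (Times (V ''e'') (V ''e''))) s 10 ?Q"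
      if "?R s \<and> words s ''K'' 0 = 2 ^ k" for s
      using that bounds by (intro runs_Put) (simp_all add: m_def)
  qed simp
  show ?thesis unfolding powers_com_def
    by (rule runs_Seq[OF start runs_Seq[OF loop stop order_refl]]) (use steps_ge(2) in linarith)+
qed

lemma runs_popcount:
  assumes "steps \<le> B" "inputs s" "words s ''K'' 0 = 2 ^ k" "words s ''M'' 0 = m" "words s ''p'' 0 = 0"
  shows "runs B popcount_com s (100 * steps) tables"
  unfolding popcount_com_def
proof (rule runs_For_linear[where b = "m + m" and t = 20
      and I = "\<lambda>i s. inputs s \<and> words s ''K'' 0 = 2 ^ k \<and> words s ''M'' 0 = m \<and> words s ''z'' 0 = i \<and>
        words s ''p'' 0 = 0 \<and> (\<forall>X<i. words s ''p'' X = popcount X)"])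
  note bounds = scalar_bounds[OF assms(1)] scalar_bounds[OF order_refl]
  let ?I = "\<lambda>i s. inputs s \<and> words s ''K'' 0 = 2 ^ k \<and> words s ''M'' 0 = m \<and> words s ''z'' 0 = i \<and>
    words s ''p'' 0 = 0 \<and> (\<forall>X<i. words s ''p'' X = popcount X)"
  fix i s assume i: "i < m + m" "?I i s"
  \<comment> \<open>For \<open>i = 0\<close> this is the initial zero; otherwise
    \<open>i div 2\<close> lies in the part already filled.\<close>
  have half: "words s ''p'' (i div 2) = popcount (i div 2)" using i(2) by (cases "i = 0") auto
  have le: "i \<le> B" "popcount i \<le> B" "i div 2 \<le> B" "popcount (i div 2) \<le> B" "i mod 2 \<le> B"
    using i(1) bounds(3,6) popcount_le[of i] popcount_le[of "i div 2"] by linarith+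
  then show "runs B (Put ''p'' (V ''z'') (Plus (Get ''p'' (Div (V ''z'') (N 2))) (Mod (V ''z'') (N 2)))) s 20
    (\<lambda>s'. words s' ''z'' 0 = i \<and> ?I (Suc i) (put ''z'' 0 (Suc i) s'))"
    using i bounds(6) half popcount_rec[of i]
    by (intro runs_Put) (auto simp: less_Suc_eq)
qed (use assms scalar_bounds[OF assms(1)] scalar_bounds[OF order_refl] in \<open>simp_all add: tables_def\<close>)

lemma runs_fill:
  assumes "steps \<le> B" "tables s"
  shows "runs B fill_com s (100 * steps)
    (\<lambda>s'. tables s' \<and> (\<forall>j<m * n. weights s' ''f'' j = (if j < n then 0 else l + 1)))"
  unfolding fill_com_def
proof (rule runs_For_linear[where b = "m * n" and t = 30
      and I = "\<lambda>i s. tables s \<and> words s ''z'' 0 = i \<and> (\<forall>j<i. weights s ''f'' j = (if j < n then 0 else l + 1))"])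
  note bounds = scalar_bounds[OF assms(1)]
  let ?I = "\<lambda>i s. tables s \<and> words s ''z'' 0 = i \<and> (\<forall>j<i. weights s ''f'' j = (if j < n then 0 else l + 1))"
  fix i s assume i: "i < m * n" "?I i s"
  then have inp: "inputs s" "i \<le> B" using bounds(8) by (auto simp: tables_def)
  show "runs B (Cond (Less (V ''z'') (V ''n'')) (WPut ''f'' (V ''z'') (WConst 0))
       (WPut ''f'' (V ''z'') (WPlus (WGet ''l'' (N 0)) (WConst 1)))) s 30
    (\<lambda>s'. words s' ''z'' 0 = i \<and> ?I (Suc i) (put ''z'' 0 (Suc i) s'))"
  proof (rule runs_Cond[where t' = 20])
    show "runs B (WPut ''f'' (V ''z'') (WConst 0)) s 20
      (\<lambda>s'. words s' ''z'' 0 = i \<and> ?I (Suc i) (put ''z'' 0 (Suc i) s'))"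
      if "bval (Less (V ''z'') (V ''n'')) s"
      using that i inp by (intro runs_WPut) (auto simp: less_Suc_eq inputsD)
    show "runs B (WPut ''f'' (V ''z'') (WPlus (WGet ''l'' (N 0)) (WConst 1))) s 20
      (\<lambda>s'. words s' ''z'' 0 = i \<and> ?I (Suc i) (put ''z'' 0 (Suc i) s'))"
      if "\<not> bval (Less (V ''z'') (V ''n'')) s"
      using that i inp by (intro runs_WPut) (auto simp: less_Suc_eq inputsD)
  qed (use i inp bounds in \<open>simp_all add: inputsD\<close>)
qed (use assms scalar_bounds[OF assms(1)] scalar_bounds[OF order_refl] in \<open>simp_all add: tablesD inputsD\<close>)

text \<open>At \<open>i = 0\<close> this describes the table left by \<open>fill_com\<close>, and at
  \<open>i = k\<close> it is \<open>initial\<close>.\<close>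

definition terminals_done :: "nat \<Rightarrow> (nat \<Rightarrow> rat) \<Rightarrow> bool" where
  "terminals_done i F \<longleftrightarrow> (\<forall>X<m. \<forall>v<n. F (X * n + v) =
     (if X = 0 \<or> (\<exists>j<i. X = 2 ^ j \<and> v = xs ! j \<or> X = 2 ^ k * 2 ^ j \<and> v = ys ! j) then 0 else l + 1))"

lemma terminals_done_Suc:
  assumes "terminals_done i F" "i < k"
  shows "terminals_done (Suc i) (F(2 ^ i * n + xs ! i := 0, 2 ^ k * 2 ^ i * n + ys ! i := 0))"
proof -
  have "xs ! i \<in> set xs" "ys ! i \<in> set ys" using assms(2) len by simp_all
  then have less: "xs ! i < n" "ys ! i < n" using xs_n ys_n by auto
  show ?thesis unfolding terminals_done_def
  proof (intro allI impI)
    fix X v assume X: "X < m" "v < n"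
    let ?P = "\<lambda>j. X = 2 ^ j \<and> v = xs ! j \<or> X = 2 ^ k * 2 ^ j \<and> v = ys ! j"
    have F: "F (X * n + v) = (if X = 0 \<or> (\<exists>j<i. ?P j) then 0 else l + 1)"
      using assms(1) X unfolding terminals_done_def by blast
    have P_Suc: "(\<exists>j<Suc i. ?P j) \<longleftrightarrow> ?P i \<or> (\<exists>j<i. ?P j)" unfolding less_Suc_eq by blast
    show "(F(2 ^ i * n + xs ! i := 0, 2 ^ k * 2 ^ i * n + ys ! i := 0)) (X * n + v)
        = (if X = 0 \<or> (\<exists>j<Suc i. ?P j) then 0 else l + 1)"
      unfolding P_Suc fun_upd_apply cell_inj[OF X(2) less(1)] cell_inj[OF X(2) less(2)] F by argo
  qed
qed

lemma runs_terminals: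
  assumes "steps \<le> B" "tables s" "\<forall>j<m * n. weights s ''f'' j = (if j < n then 0 else l + 1)"
  shows "runs B terminals_com s (200 * steps) (\<lambda>s'. tables s' \<and> initial (weights s' ''f''))"
  unfolding terminals_com_def
proof (rule runs_Seq)
  note bounds = scalar_bounds[OF assms(1)] scalar_bounds[OF order_refl]
  let ?I = "\<lambda>i s. tables s \<and> words s ''z'' 0 = i \<and> words s ''e'' 0 = 2 ^ i \<and> terminals_done i (weights s ''f'')"
  have "terminals_done 0 (weights s ''f'')"
  proof -
    have "X * n + v < m * n" if "X < m" "v < n" for X v
    proof -
      have "X * n + v < Suc X * n" using that by simp
      also have "\<dots> \<le> m * n" using that by (intro mult_le_mono1) simp
      finally show ?thesis .
    qed
    moreover have "X * n + v < n \<longleftrightarrow> X = 0" if "v < n" for X v using that by (cases X) auto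
    ultimately show ?thesis using assms(3) by (simp add: terminals_done_def)
  qed
  then show "runs B (Put ''e'' (N 0) (N 1)) s 3
    (\<lambda>s. tables s \<and> words s ''e'' 0 = 1 \<and> terminals_done 0 (weights s ''f''))"
    using assms bounds by (intro runs_Put) simp_all
  fix s assume start: "tables s \<and> words s ''e'' 0 = 1 \<and> terminals_done 0 (weights s ''f'')"
  let ?c3 = "Put ''e'' (N 0) (Plus (V ''e'') (V ''e''))"
  let ?a1 = "cell (V ''e'') (Get ''S'' (V ''z''))"
  let ?a2 = "cell (Times (V ''K'') (V ''e'')) (Get ''T'' (V ''z''))"
  show "runs B (For (V ''k'') (Seq (WPut ''f'' ?a1 (WConst 0)) (Seq (WPut ''f'' ?a2 (WConst 0)) ?c3)))
     s (150 * steps) (\<lambda>s'. tables s' \<and> initial (weights s' ''f''))"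
  proof (rule runs_For_linear[where I = ?I and b = k and t = 60])
    fix i s assume i: "i < k" "?I i s"
    have "xs ! i \<in> set xs" "ys ! i \<in> set ys" using i(1) len by simp_all
    then have ti: "xs ! i < n" "ys ! i < n" using xs_n ys_n by auto
    have pow: "(2::nat) ^ i \<le> 2 ^ k" "2 ^ Suc i \<le> (2::nat) ^ k"
      using i(1) by (intro power_increasing; simp)+
    have "2 ^ k * 2 ^ i \<le> m" "1 * 2 ^ i \<le> m" unfolding m_def using pow(1) by (intro mult_le_mono; simp)+
    then have less: "2 ^ k * 2 ^ i < m + m" "2 ^ i < m + m" using m_pos by linarith+
    have inp: "inputs s" using i by (simp add: tables_def)
    have le: "2 ^ k * 2 ^ i \<le> B" "2 ^ i \<le> B" "xs ! i \<le> B" "ys ! i \<le> B" "i \<le> B"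
      "2 ^ i * n + xs ! i \<le> B" "2 ^ k * 2 ^ i * n + ys ! i \<le> B"
      using less ti bounds(1,3,4) bounds(7)[OF less(1) ti(2)] bounds(7)[OF less(2) ti(1)] i(1) by linarith+
    let ?F = "weights s ''f''"
    let ?R1 = "\<lambda>s'. tables s' \<and> words s' ''z'' 0 = i \<and> words s' ''e'' 0 = 2 ^ i \<and>
      weights s' ''f'' = ?F(2 ^ i * n + xs ! i := 0)"
    let ?R2 = "\<lambda>s'. tables s' \<and> words s' ''z'' 0 = i \<and> words s' ''e'' 0 = 2 ^ i \<and>
      weights s' ''f'' = ?F(2 ^ i * n + xs ! i := 0, 2 ^ k * 2 ^ i * n + ys ! i := 0)"
    show "runs B (Seq (WPut ''f'' ?a1 (WConst 0)) (Seq (WPut ''f'' ?a2 (WConst 0)) ?c3)) s 60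
      (\<lambda>s'. words s' ''z'' 0 = i \<and> ?I (Suc i) (put ''z'' 0 (Suc i) s'))"
    proof (rule runs_Seq[where R = ?R1 and tb = 40])
      show "runs B (WPut ''f'' ?a1 (WConst 0)) s 20 ?R1"
        using i inp le bounds(1)
        by (intro runs_WPut afits_cell) (simp_all add: aval_cell inputsD acost_exprs)
      fix s assume R1: "?R1 s"
      then have inp: "inputs s" by (simp add: tables_def)
      show "runs B (Seq (WPut ''f'' ?a2 (WConst 0)) ?c3) s 40
        (\<lambda>s'. words s' ''z'' 0 = i \<and> ?I (Suc i) (put ''z'' 0 (Suc i) s'))"
      proof (rule runs_Seq[where R = ?R2 and tb = 10])
        show "runs B (WPut ''f'' ?a2 (WConst 0)) s 30 ?R2"
          using i R1 inp le bounds(1,5)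
          by (intro runs_WPut afits_cell) (simp_all add: aval_cell inputsD tablesD acost_exprs)
        show "runs B ?c3 s 10 (\<lambda>s'. words s' ''z'' 0 = i \<and> ?I (Suc i) (put ''z'' 0 (Suc i) s'))"
          if "?R2 s" for s
          using that i(2) le(2) pow(2) bounds(5) terminals_done_Suc[OF _ i(1), of ?F]
          by (intro runs_Put) simp_all
      qed simp
    qed simp
  qed (use start assms bounds in \<open>simp_all add: tablesD inputsD terminals_done_def initial_def\<close>)
qed (use steps_ge(2) in simp)

lemma runs_rounds:
  assumes "steps \<le> B" "tables s"
  shows "runs B rounds_com s (800 * steps)
    (\<lambda>s'. tables s' \<and> weights s' ''f'' = iter steps (weights s ''f''))"
  unfolding rounds_com_def
proof (rule runs_For_linear[where b = steps and t = 600
      and I = "\<lambda>i s'. tables s' \<and> words s' ''z'' 0 = i \<and> weights s' ''f'' = iter i (weights s ''f'')"])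
  note bounds = scalar_bounds[OF assms(1)]
  let ?I = "\<lambda>i s'. tables s' \<and> words s' ''z'' 0 = i \<and> weights s' ''f'' = iter i (weights s ''f'')"
  fix i s' assume I: "?I i s'"
  then have inp: "inputs s'" by (simp add: tables_def)
  have le: "2 * k + 4 \<le> B" "2 * k \<le> B" "2 \<le> B" "4 \<le> B" "(2 * k + 4) * n \<le> B" "m * m \<le> B" "m * m * n \<le> B"
    "m * m * n * n \<le> B" "(2 * k + 4) * n * (m * m * n * n) \<le> B"
    using steps_ge assms(1) unfolding round_length_def[symmetric] steps_def[symmetric] by linarith+
  show "words s' ''z'' 0 = i \<and>
      afits B (Times (Times (Plus (Times (N 2) (V ''k'')) (N 4)) (V ''n''))
        (Times (Times (Times (V ''M'') (V ''M'')) (V ''n'')) (V ''n''))) s' \<and>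
      aval (Times (Times (Plus (Times (N 2) (V ''k'')) (N 4)) (V ''n''))
        (Times (Times (Times (V ''M'') (V ''M'')) (V ''n'')) (V ''n''))) s' = steps"
    using I le bounds(1,2,4) unfolding steps_def round_length_def
    by (simp add: inputsD[OF inp] tablesD del: mult_Suc_right)
  assume "i < steps"
  then have "i \<le> B" using assms(1) by simp
  show "runs B (Seq merge_com move_com) s' 600
      (\<lambda>s''. words s'' ''z'' 0 = i \<and> ?I (Suc i) (put ''z'' 0 (Suc i) s''))"
    by (rule runs_mono[OF runs_step[OF assms(1) _ _ \<open>i \<le> B\<close>]]) (use I in simp_all)
qed (use assms scalar_bounds[OF order_refl] in simp_all)

lemma runs_answer:
  assumes "steps \<le> B" "tables s"
  shows "runs B answer_com s (8 * steps)
    (\<lambda>s'. words s' ''out'' 0 = (if weights s ''f'' ((m - 1) * n) \<le> l then 1 else 0))"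
  unfolding answer_com_def
proof (rule runs_Cond[where t' = 3])
  note bounds = scalar_bounds[OF assms(1)]
  have "(m - 1) * n \<le> m * n" by (intro mult_le_mono1) simp
  then have "(m - 1) * n \<le> B" using bounds(8) by (rule order_trans)
  then show "bfits B (WLess (WGet ''l'' (N 0)) (WGet ''f'' (Times (Minus (V ''M'') (N 1)) (V ''n'')))) s"
    using bounds assms by (simp add: inputsD tablesD)
qed (use assms scalar_bounds[OF assms(1)] scalar_bounds[OF order_refl] in
  \<open>auto intro!: runs_Put simp: inputsD tablesD\<close>)

text \<open>The parts take \<open>100 + 100 + 100 + 200 + 800 + 8\<close> times
  \<open>steps\<close>; \<open>2000\<close> is a generous rounding that also covers the initial test
  of the budget.\<close>

lemma runs_program:
  assumes "inputs s" "words s ''p'' 0 = 0" "2000 * steps \<le> B"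
  shows "runs B program s (2000 * steps) (\<lambda>s'. words s' ''out'' 0 =
    (if \<exists>K f. K \<subseteq> E \<and> sum w K \<le> l \<and> bij_betw f (occs (mset xs)) (occs (mset ys)) \<and>
      (\<forall>s\<in>occs (mset xs). (fst s, fst (f s)) \<in> K\<^sup>*) then 1 else 0))" (is "runs _ _ _ _ ?Q")
proof -
  have B: "steps \<le> B" using assms(3) by simp
  have "runs B (Seq fill_com (Seq terminals_com (Seq rounds_com answer_com))) s (1200 * steps) ?Q"
    if "tables s" for s
  proof (rule runs_Seq[OF runs_fill[OF B that], where tb = "1100 * steps"])
    fix s assume s: "tables s \<and> (\<forall>j<m * n. weights s ''f'' j = (if j < n then 0 else l + 1))"
    show "runs B (Seq terminals_com (Seq rounds_com answer_com)) s (1100 * steps) ?Q"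
    proof (rule runs_Seq[OF runs_terminals[OF B], where tb = "900 * steps"])
      fix s assume s: "tables s \<and> initial (weights s ''f'')"
      then have s: "tables s" "initial (weights s ''f'')" by auto
      show "runs B (Seq rounds_com answer_com) s (900 * steps) ?Q"
        by (rule runs_Seq[OF runs_rounds[OF B s(1)], where tb = "8 * steps"],
            rule runs_mono[OF runs_answer[OF B]])
          (use iter_correct[OF s(2)] in \<open>auto simp: steps_def[symmetric]\<close>)
    qed (use s in auto)
  qed simp
  then have "runs B (Seq powers_com (Seq popcount_com (Seq fill_com (Seq terminals_com (Seq rounds_com answer_com)))))
      s (1500 * steps) ?Q"
    by (intro runs_Seq[OF runs_powers[OF B assms(1,2)], where tb = "1400 * steps"]
        runs_Seq[OF runs_popcount[OF B], where tb = "1200 * steps"]) auto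
  then show ?thesis unfolding program_def using steps_ge(2) l_nonneg assms(1)
    by (intro runs_Cond[where t' = "1500 * steps"]) (simp_all add: inputsD)
qed

end

section \<open>Asymptotics and the two cases of the budget\<close>

lemma routing_instance:
  assumes "wf_inst I" "mset xs = sources I" "mset ys = targets I" "0 \<le> budget I"
  shows "routing (nverts I) (size (sources I)) (arcs I) (weight I) xs ys (of_int (budget I))"
proof
  show "length xs = size (sources I)" "length ys = size (sources I)"
    using assms(1) unfolding wf_inst_def assms(2,3)[symmetric] by simp_all
  show "set xs \<subseteq> {..<nverts I}" "set ys \<subseteq> {..<nverts I}"
    using assms(1) unfolding wf_inst_def assms(2,3)[symmetric] by simp_all
qed (use assms in \<open>auto simp: wf_inst_def\<close>)

text \<open>The exponent is in fact linear in \<open>k\<close>: \<open>2000\<close> is at most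
  \<open>2 ^ 11\<close>, the linear factor at most \<open>2 ^ (k + 3)\<close>, and
  \<open>16 ^ k\<close> comes from the pairs of codes. From \<open>k = 2\<close> on,
  \<open>log 2 (real k)\<close> is at least one, and \<open>14 + 5 * k \<le> 19 * k\<close> yields
  the constant.\<close>

lemma time_bound:
  "(\<lambda>k. log 2 (2000 * ((2 * real k + 4) * 16 ^ k))) \<in> O(\<lambda>k. real k * log 2 (real k))"
proof (rule bigoI[of _ 19])
  show "\<forall>\<^sub>F k in sequentially. norm (log 2 (2000 * ((2 * real k + 4) * 16 ^ k)))
    \<le> 19 * norm (real k * log 2 (real k))"
    using eventually_ge_at_top[of 2]
  proof eventually_elim
    case (elim k)
    have "2 * real k + 4 \<le> 8 * 2 ^ k"
    proof -
      have "real k < 2 ^ k" by (rule of_nat_less_two_power)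
      moreover have "(1::real) \<le> 2 ^ k" by simp
      ultimately show ?thesis by linarith
    qed
    then have "2000 * ((2 * real k + 4) * 16 ^ k) \<le> 2048 * ((8 * 2 ^ k) * 16 ^ k)"
      by (intro mult_mono) simp_all
    also have "\<dots> = 2 ^ (14 + 5 * k)"
      by (simp add: power_add power_mult flip: power_mult_distrib)
    finally have "log 2 (2000 * ((2 * real k + 4) * 16 ^ k)) \<le> log 2 (2 ^ (14 + 5 * k))"
      by (intro log_mono) (simp_all add: add_pos_pos)
    also have "\<dots> = real (14 + 5 * k)" by (subst log_nat_power) simp_all
    also have "\<dots> \<le> 19 * real k" using elim by simp
    also have "\<dots> \<le> 19 * (real k * log 2 (real k))"
      using elim by (simp add: le_log_iff)
    finally have le: "log 2 (2000 * ((2 * real k + 4) * 16 ^ k)) \<le> 19 * (real k * log 2 (real k))" .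
    have "1 * (1 * 1) \<le> 2000 * ((2 * real k + 4) * 16 ^ k)" by (intro mult_mono) simp_all
    then have "0 \<le> log 2 (2000 * ((2 * real k + 4) * 16 ^ k))" by simp
    with le show ?case by simp
  qed
qed

theorem theorem4:
  "\<exists>(P :: com) (g :: nat \<Rightarrow> real).
     g \<in> O(\<lambda>k. real k * log 2 (real k)) \<and>
     (\<forall>I xs ys. wf_inst I \<and> mset xs = sources I \<and> mset ys = targets I \<longrightarrow>
        decides_within P (init_state I xs ys)
          (nat \<lfloor>2 powr g (size (sources I)) * real (nverts I) ^ 3\<rfloor>)
          (yes_inst I))"
proof (intro exI conjI allI impI)
  show "(\<lambda>k. log 2 (2000 * ((2 * real k + 4) * 16 ^ k))) \<in> O(\<lambda>k. real k * log 2 (real k))"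
    by (rule time_bound)
next
  fix I xs ys
  assume asm: "wf_inst I \<and> mset xs = sources I \<and> mset ys = targets I"
  define n where "n = nverts I"
  define k where "k = size (sources I)"
  define s where "s = init_state I xs ys"
  \<comment> \<open>The bound is a natural number, so the floor in the claim is exact; the same
    number bounds the words.\<close>
  define t where "t = 2000 * ((2 * k + 4) * n * (2 ^ k * 2 ^ k * (2 ^ k * 2 ^ k) * n * n))"
  have n_pos: "0 < n" using asm by (simp add: n_def wf_inst_def)
  have "2 powr log 2 (2000 * ((2 * real k + 4) * 16 ^ k)) = 2000 * ((2 * real k + 4) * 16 ^ k)"
    by (intro powr_log_cancel) (simp_all add: add_pos_pos)
  moreover have "(16::real) ^ k = 2 ^ k * 2 ^ k * (2 ^ k * 2 ^ k)"
    by (simp flip: power_mult_distrib)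
  ultimately have "2 powr log 2 (2000 * ((2 * real k + 4) * 16 ^ k)) * real n ^ 3 = real t"
    by (simp add: t_def power3_eq_cube)
  then have time: "nat \<lfloor>2 powr log 2 (2000 * ((2 * real k + 4) * 16 ^ k)) * real n ^ 3\<rfloor> = t" by simp
  have l: "weights s ''l'' 0 = of_int (budget I)" by (simp add: s_def init_state_def Let_def scalar_def)
  have "runs t program s t (\<lambda>s'. words s' ''out'' 0 = (if yes_inst I then 1 else 0))"
  proof (cases "0 \<le> budget I")
    case True
    interpret routing n k "arcs I" "weight I" xs ys "of_int (budget I)"
      unfolding n_def k_def using routing_instance asm True by blast
    have "words s ''A'' (u * n + v) = (if (u, v) \<in> arcs I then 1 else 0)"
      "(u, v) \<in> arcs I \<Longrightarrow> weights s ''w'' (u * n + v) = weight I (u, v)" if "v < n" for u v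
      using that by (simp_all add: s_def init_state_def Let_def n_def[symmetric])
    then have "inputs s"
      unfolding inputs_def using l len
      by (simp add: s_def init_state_def Let_def n_def[symmetric] scalar_def array_def)
    moreover have "words s ''p'' 0 = 0" by (simp add: s_def init_state_def Let_def)
    moreover have "2000 * steps = t"
      by (simp add: t_def steps_def round_length_def m_def)
    ultimately show ?thesis using runs_program[of s t] asm by (simp add: yes_inst_def)
  next
    case False
    have "\<not> yes_inst I"
    proof
      assume "yes_inst I"
      then obtain K where K: "K \<subseteq> arcs I" "(\<Sum>e\<in>K. weight I e) \<le> of_int (budget I)"
        by (auto simp: yes_inst_def)
      have "0 \<le> (\<Sum>e\<in>K. weight I e)" using K(1) asm by (intro sum_nonneg) (auto simp: wf_inst_def)
      also note K(2)
      finally show False using False by simp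
    qed
    moreover have "2000 * 1 \<le> t" unfolding t_def using n_pos by (intro mult_le_mono2) simp
    \<comment> \<open>The rejecting branch takes \<open>8\<close> units: \<open>4\<close> for the
      test, \<open>3\<close> for the assignment and \<open>1\<close> for branching.\<close>
    then have "8 \<le> t" by simp
    ultimately show ?thesis unfolding program_def using False l
      by (intro runs_Cond[where t' = 3]) (auto intro!: runs_Put)
  qed
  then show "decides_within program (init_state I xs ys)
      (nat \<lfloor>2 powr log 2 (2000 * ((2 * real (size (sources I)) + 4) * 16 ^ size (sources I)))
        * real (nverts I) ^ 3\<rfloor>) (yes_inst I)"
    unfolding decides_within_def runs_def s_def[symmetric] n_def[symmetric] k_def[symmetric] time .
qed

end
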